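(* Let $T$ be an additive tree of type $2=\{0,1\}$ with height $\alpha$ a tail-like ordinal, such that $h(\bar 0)=h(\bar 1)=\alpha$. Then the branch space $X(T)$ is a compact, perfect, zero-dimensional LOTS which satisfies the clopen interval condition. In addition, if $\alpha$ is countable, then $X(T)$ is topologically homogeneous.
   Context: A LOTS is a totally ordered set with the order topology. It is perfect if it has no isolated points, zero-dimensional if the clopen convex sets form a base. It satisfies the clopen interval condition if any two (nonempty) bounded clopen intervals are order isomorphic. A topological space is topologically homogeneous if its homeomorphism group acts transitively on it. An ordinal $\alpha$ is tail-like if $\alpha>0$ and $\beta+\alpha=\alpha$ for all $\beta<\alpha$. Let $2=\{0,1\}$ with $0<1$. The simple tree on $2,\alpha$ has as vertices of order $i<\alpha$ the functions $i\to\{0,1\}$, with tree order $q\prec p$ iff $p$ properly extends $q$. For $p\in 2^i,q\in 2^j$, $p+q\in2^{i+j}$ is the concatenation: $(p+q)(k)=p(k)$ for $k<i$, $(p+q)(i+k)=q(k)$ for $k<j$. An additive tree of type $2$ and height $\alpha$ is a subset $T$ of the simple tree on $2,\alpha$ which contains the root $\emptyset$ and both vertices of order $1$, which satisfies, for all vertices $p,q$ of the simple tree, $p+q\in T$ iff $p,q\in T$, and for which $\alpha$ is the least ordinal exceeding the orders (domains) of all elements of $T$. (Such a $T$ is closed under restrictions to initial segments.) A branch of $T$ is a maximal linearly ordered subset; its height $h(x)$ is its order type, and it is identified with the function $x:h(x)\to\{0,1\}$ which is its union. The branch space $X(T)$ is the set of branches, ordered by $x<y$ iff there is $\epsilon<h(x),h(y)$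 with $x(i)=y(i)$ for $i<\epsilon$, $x(\epsilon)=0$, $y(\epsilon)=1$. $\bar0$ (resp. $\bar1$) denotes the unique branch which is constantly $0$ (resp. constantly $1$). *)

theory Defs
  imports "HOL-Analysis.Analysis"
begin

section \<open>Order isomorphism and linearly ordered topological spaces\<close>

definition order_isomorphic ::
    "('a \<Rightarrow> 'a \<Rightarrow> bool) \<Rightarrow> 'a set \<Rightarrow> ('b \<Rightarrow> 'b \<Rightarrow> bool) \<Rightarrow> 'b set \<Rightarrow> bool" where
  "order_isomorphic R A S B \<longleftrightarrow>
     (\<exists>f. bij_betw f A B \<and> (\<forall>x\<in>A. \<forall>y\<in>A. R x y \<longleftrightarrow> S (f x) (f y)))"

text \<open>A LOTS is given by a carrier \<open>X\<close> and a strict linear order \<open>r \<subseteq> X \<times> X\<close>; it carries the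
  topology generated by the open rays.  The carrier is added to the subbase because a one-point
  order has no nonempty open rays.\<close>

definition lots_topology :: "'a set \<Rightarrow> 'a rel \<Rightarrow> 'a topology" where
  "lots_topology X r = topology_generated_by
     (insert X ((\<lambda>a. {x \<in> X. (a, x) \<in> r}) ` X \<union> (\<lambda>a. {x \<in> X. (x, a) \<in> r}) ` X))"

definition lots :: "'a set \<Rightarrow> 'a rel \<Rightarrow> bool" where
  "lots X r \<longleftrightarrow> r \<subseteq> X \<times> X \<and> strict_linear_order_on X r"

definition perfect_lots :: "'a set \<Rightarrow> 'a rel \<Rightarrow> bool" where
  "perfect_lots X r \<longleftrightarrow> (\<forall>x\<in>X. \<not> openin (lots_topology X r) {x})"

definition order_convex :: "'a set \<Rightarrow> 'a rel \<Rightarrow> 'a set \<Rightarrow> bool" where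
  "order_convex X r J \<longleftrightarrow>
     J \<subseteq> X \<and> (\<forall>x\<in>J. \<forall>z\<in>J. \<forall>y\<in>X. (x, y) \<in> r \<and> (y, z) \<in> r \<longrightarrow> y \<in> J)"

definition clopen_convex :: "'a set \<Rightarrow> 'a rel \<Rightarrow> 'a set \<Rightarrow> bool" where
  "clopen_convex X r J \<longleftrightarrow> order_convex X r J \<and>
     openin (lots_topology X r) J \<and> closedin (lots_topology X r) J"

definition zero_dimensional_lots :: "'a set \<Rightarrow> 'a rel \<Rightarrow> bool" where
  "zero_dimensional_lots X r \<longleftrightarrow>
     (\<forall>U x. openin (lots_topology X r) U \<and> x \<in> U \<longrightarrow>
        (\<exists>J. clopen_convex X r J \<and> x \<in> J \<and> J \<subseteq> U))"

definition order_bounded :: "'a set \<Rightarrow> 'a rel \<Rightarrow> 'a set \<Rightarrow> bool" where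
  "order_bounded X r J \<longleftrightarrow>
     (\<exists>a\<in>X. \<exists>b\<in>X. \<forall>x\<in>J. (a, x) \<in> r\<^sup>= \<and> (x, b) \<in> r\<^sup>=)"

text \<open>Intervals are convex sets.  In a compact LOTS the nonempty clopen convex sets are exactly the
  nonempty clopen sets of the form \<open>[a, b]\<close>, so there it makes no difference whether an interval
  is required to have end points.\<close>

definition clopen_interval_condition :: "'a set \<Rightarrow> 'a rel \<Rightarrow> bool" where
  "clopen_interval_condition X r \<longleftrightarrow>
     (\<forall>J K. clopen_convex X r J \<and> order_bounded X r J \<and> J \<noteq> {} \<and>
            clopen_convex X r K \<and> order_bounded X r K \<and> K \<noteq> {} \<longrightarrow>
        order_isomorphic (\<lambda>x y. (x, y) \<in> r) J (\<lambda>x y. (x, y) \<in> r) K)"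

definition topologically_homogeneous :: "'a topology \<Rightarrow> bool" where
  "topologically_homogeneous \<tau> \<longleftrightarrow>
     (\<forall>x\<in>topspace \<tau>. \<forall>y\<in>topspace \<tau>. \<exists>f. homeomorphic_map \<tau> \<tau> f \<and> f x = y)"


section \<open>Ordinals\<close>

text \<open>Ordinals are the elements of an arbitrary well-ordered type \<open>'o\<close>, the element \<open>i\<close> standing for
  the order type of \<open>{..<i}\<close>.  Since \<open>'o\<close> need not be closed under ordinal addition, addition is a
  relation: \<open>ord_sum a b c\<close> says that \<open>c = a + b\<close>, i.e. that the final segment \<open>{a..<c}\<close> of \<open>c\<close> has
  order type \<open>b\<close>.\<close>

definition ord_zero :: "'o::wellorder" where
  "ord_zero = (LEAST i. True)"

definition ord_sum :: "'o::wellorder \<Rightarrow> 'o \<Rightarrow> 'o \<Rightarrow> bool" where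
  "ord_sum a b c \<longleftrightarrow> a \<le> c \<and> order_isomorphic (<) {..<b} (<) {a..<c}"

definition tail_like :: "'o::wellorder \<Rightarrow> bool" where
  "tail_like \<alpha> \<longleftrightarrow> \<alpha> > ord_zero \<and> (\<forall>\<beta><\<alpha>. ord_sum \<beta> \<alpha> \<alpha>)"


section \<open>Additive trees of type 2\<close>

text \<open>A function \<open>i \<rightarrow> {0, 1}\<close> is a partial map with domain \<open>{..<i}\<close>; \<open>len\<close> recovers \<open>i\<close> from it.
  The values 0 and 1 are \<open>False\<close> and \<open>True\<close>.\<close>

definition simple_tree :: "'o::wellorder \<Rightarrow> ('o \<rightharpoonup> bool) set" where
  "simple_tree \<alpha> = {p. \<exists>i<\<alpha>. dom p = {..<i}}"

definition len :: "('o::wellorder \<rightharpoonup> bool) \<Rightarrow> 'o" where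
  "len p = (THE i. dom p = {..<i})"

definition tree_less :: "('o \<rightharpoonup> bool) \<Rightarrow> ('o \<rightharpoonup> bool) \<Rightarrow> bool" where
  "tree_less q p \<longleftrightarrow> q \<subseteq>\<^sub>m p \<and> q \<noteq> p"

text \<open>\<open>is_concat p q r\<close> says that \<open>r = p + q\<close>.\<close>

definition is_concat ::
    "('o::wellorder \<rightharpoonup> bool) \<Rightarrow> ('o \<rightharpoonup> bool) \<Rightarrow> ('o \<rightharpoonup> bool) \<Rightarrow> bool" where
  "is_concat p q r \<longleftrightarrow>
     dom r = {..<len r} \<and> ord_sum (len p) (len q) (len r) \<and>
     (\<forall>k<len p. r k = p k) \<and>
     (\<forall>k<len q. \<forall>m. ord_sum (len p) k m \<longrightarrow> r m = q k)"

definition additive_tree :: "('o::wellorder \<rightharpoonup> bool) set \<Rightarrow> 'o \<Rightarrow> bool" where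
  "additive_tree T \<alpha> \<longleftrightarrow>
     T \<subseteq> simple_tree \<alpha> \<and>
     Map.empty \<in> T \<and>
     (\<forall>b. [ord_zero \<mapsto> b] \<in> T) \<and>
     (\<forall>p\<in>simple_tree \<alpha>. \<forall>q\<in>simple_tree \<alpha>.
        (\<exists>r\<in>T. is_concat p q r) \<longleftrightarrow> p \<in> T \<and> q \<in> T) \<and>
     \<alpha> = (LEAST \<beta>. \<forall>p\<in>T. len p < \<beta>)"

text \<open>Branches are identified with the unions of the maximal chains of \<open>T\<close>.  The height of a
  branch \<open>x\<close> is \<open>len x\<close>; lemma \<open>len_branch\<close> below shows that this is the order type of the chain.\<close>

definition branch_space :: "('o \<rightharpoonup> bool) set \<Rightarrow> ('o \<rightharpoonup> bool) set" where
  "branch_space T =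
     {x. \<exists>C. pred_on.maxchain T tree_less C \<and> Map.graph x = (\<Union>p\<in>C. Map.graph p)}"

definition branch_order :: "('o::wellorder \<rightharpoonup> bool) set \<Rightarrow> ('o \<rightharpoonup> bool) rel" where
  "branch_order T =
     {(x, y). x \<in> branch_space T \<and> y \<in> branch_space T \<and>
        (\<exists>\<epsilon>. \<epsilon> < len x \<and> \<epsilon> < len y \<and> (\<forall>i<\<epsilon>. x i = y i) \<and>
             x \<epsilon> = Some False \<and> y \<epsilon> = Some True)}"

definition const_branch :: "('o \<rightharpoonup> bool) set \<Rightarrow> bool \<Rightarrow> ('o \<rightharpoonup> bool)" where
  "const_branch T b = (THE x. x \<in> branch_space T \<and> ran x \<subseteq> {b})"

abbreviation branch_topology :: "('o::wellorder \<rightharpoonup> bool) set \<Rightarrow> ('o \<rightharpoonup> bool) topology" where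
  "branch_topology T \<equiv> lots_topology (branch_space T) (branch_order T)"


section \<open>The height of a branch is the order type of the chain\<close>

lemma len_eqI: "dom p = {..<i} \<Longrightarrow> len p = i"
  unfolding len_def by (rule the_equality) auto

lemma simple_tree_dom: "p \<in> simple_tree \<alpha> \<Longrightarrow> dom p = {..<len p}"
  unfolding simple_tree_def by (elim CollectE exE conjE) (simp only: len_eqI)

lemma simple_tree_len: "p \<in> simple_tree \<alpha> \<Longrightarrow> len p < \<alpha>"
  unfolding simple_tree_def by (elim CollectE exE conjE) (simp only: len_eqI)

lemma ord_diff_exists:
  fixes i :: "'o::wellorder"
  shows "\<exists>g. \<forall>k\<ge>i. g k \<le> k \<and> (\<forall>k'\<ge>i. k' < k \<longrightarrow> g k' < g k) \<and> g ` {i..<k} = {..<g k}"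
proof -
  define F where "F f k = (LEAST y. \<forall>k'\<in>{i..<k}. f k' < y)" for f :: "'o \<Rightarrow> 'o" and k
  define g where "g = wfrec {(x, y). x < y} F"
  have wf: "wf {(x, y). x < (y::'o)}" by (rule wf)
  have g: "g k = (LEAST y. \<forall>k'\<in>{i..<k}. g k' < y)" for k
  proof -
    have "g k = F (cut g {(x, y). x < y} k) k"
      unfolding g_def by (rule wfrec[OF wf])
    also have "\<dots> = F g k"
      unfolding F_def by (rule arg_cong[where f = Least]) (auto simp: cut_def fun_eq_iff)
    finally show ?thesis by (simp add: F_def)
  qed
  have le: "g k \<le> k" for k
  proof (induction k rule: less_induct)
    case (less k)
    show ?case by (subst g, rule Least_le) (use less in fastforce)
  qed
  have mono: "g k' < g k" if "i \<le> k'" "k' < k" for k k'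
  proof -
    have "\<forall>k'\<in>{i..<k}. g k' < k" using le by (meson atLeastLessThan_iff le_less_trans)
    hence "\<forall>k'\<in>{i..<k}. g k' < g k" by (subst g, rule LeastI)
    thus ?thesis using that by auto
  qed
  have surj: "y \<in> g ` {i..<k}" if "y < g k" for y k
    using that
  proof (induction k rule: less_induct)
    case (less k)
    have "\<not> (\<forall>k'\<in>{i..<k}. g k' < y)"
      by (rule not_less_Least) (use less.prems g[of k] in simp)
    then obtain k' where k': "k' \<in> {i..<k}" "y \<le> g k'" by (auto simp: not_less)
    show ?case
    proof (cases "y = g k'")
      case False
      with k' have "y \<in> g ` {i..<k'}" using less.IH[of k'] by auto
      thus ?thesis using k' by auto
    qed (use k' in auto)
  qed
  show ?thesis
    by (rule exI[of _ g]) (use le mono surj in auto)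
qed

lemma additive_tree_restrict:
  assumes T: "additive_tree T \<alpha>" and p: "p \<in> T" and i: "i \<le> len p"
  shows "p |` {..<i} \<in> T"
proof -
  have pS: "p \<in> simple_tree \<alpha>" using T p unfolding additive_tree_def by auto
  note dp = simple_tree_dom[OF pS] and lp = simple_tree_len[OF pS]
  obtain g where g: "\<And>k. i \<le> k \<Longrightarrow> g k \<le> k"
      "\<And>k k'. i \<le> k' \<Longrightarrow> k' < k \<Longrightarrow> g k' < g k"
      "\<And>k. i \<le> k \<Longrightarrow> g ` {i..<k} = {..<g k}"
    using ord_diff_exists[of i] by (metis order.trans less_imp_le)
  have inj: "inj_on g {i..}"
    by (rule linorder_inj_onI') (use g(2) in \<open>fastforce\<close>)
  define b where "b = g (len p)"
  define q where "q j = (if j < b then p (the_inv_into {i..} g j) else None)" for j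
  have q: "q (g m) = p m" if "i \<le> m" "m < len p" for m
  proof -
    have "g m < b" unfolding b_def using g(2) that by blast
    moreover have "the_inv_into {i..} g (g m) = m" using inj that by (simp add: the_inv_into_f_f)
    ultimately show ?thesis by (simp add: q_def)
  qed
  have "dom q = {..<b}"
  proof -
    have "q j \<noteq> None" if "j < b" for j
    proof -
      have "j \<in> g ` {i..<len p}" unfolding g(3)[OF i] using that by (simp add: b_def)
      then obtain m where m: "i \<le> m" "m < len p" "j = g m" by auto
      hence "m \<in> dom p" by (subst dp) simp
      thus ?thesis using q[OF m(1,2)] m(3) by auto
    qed
    moreover have "q j = None" if "\<not> j < b" for j using that by (simp add: q_def)
    ultimately have "j \<in> dom q \<longleftrightarrow> j \<in> {..<b}" for j unfolding domIff lessThan_iff by metis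
    thus ?thesis by (rule set_eqI)
  qed
  moreover have "b < \<alpha>" using g(1)[OF i] lp unfolding b_def by (rule le_less_trans)
  ultimately have qS: "q \<in> simple_tree \<alpha>" and lq: "len q = b"
    unfolding simple_tree_def using len_eqI by blast+
  have dr: "dom (p |` {..<i}) = {..<i}" unfolding dom_restrict dp using i by auto
  have lr: "len (p |` {..<i}) = i" using dr by (rule len_eqI)
  have rS: "p |` {..<i} \<in> simple_tree \<alpha>"
    unfolding simple_tree_def using dr le_less_trans[OF i lp] by blast
  have iso: "\<exists>f. bij_betw f {..<g c} {i..<c} \<and> (\<forall>x\<in>{..<g c}. \<forall>y\<in>{..<g c}. x < y \<longleftrightarrow> f x < f y)
     \<and> (\<forall>m\<in>{i..<c}. f (g m) = m)" if ic: "i \<le> c" for c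
  proof (intro exI conjI)
    let ?f = "the_inv_into {i..<c} g"
    have inj': "inj_on g {i..<c}" using inj by (rule inj_on_subset) auto
    show "bij_betw ?f {..<g c} {i..<c}"
      using bij_betw_the_inv_into[of g "{i..<c}" "{..<g c}"] inj' g(3)[OF that]
      by (auto simp: bij_betw_def)
    show fg: "\<forall>m\<in>{i..<c}. ?f (g m) = m" using inj' by (auto simp: the_inv_into_f_f)
    show "\<forall>x\<in>{..<g c}. \<forall>y\<in>{..<g c}. x < y \<longleftrightarrow> ?f x < ?f y"
    proof (intro ballI)
      fix x y assume "x \<in> {..<g c}" "y \<in> {..<g c}"
      then obtain m n where mn: "m \<in> {i..<c}" "x = g m" "n \<in> {i..<c}" "y = g n"
        unfolding g(3)[OF ic, symmetric] by blast
      have "g m < g n \<longleftrightarrow> m < n"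
        using g(2)[of m n] g(2)[of n m] mn by (cases m n rule: linorder_cases) auto
      thus "x < y \<longleftrightarrow> ?f x < ?f y" using mn fg by auto
    qed
  qed
  have os: "ord_sum i (g c) c" if "i \<le> c" for c
    using iso[OF that] that unfolding ord_sum_def order_isomorphic_def by blast
  have un: "g m = k" if "ord_sum i k m" for k m
  proof -
    obtain f where f: "bij_betw f {..<k} {i..<m}"
        "\<And>x y. x < k \<Longrightarrow> y < k \<Longrightarrow> x < y \<longleftrightarrow> f x < f y" and im: "i \<le> m"
      using \<open>ord_sum i k m\<close> unfolding ord_sum_def order_isomorphic_def by auto
    have fr: "f x \<in> {i..<m}" if "x < k" for x using f(1) that by (auto simp: bij_betw_def)
    have gf: "g (f x) = x" if "x < k" for x using that
    proof (induction x rule: less_induct)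
      case (less x)
      have "g ` {i..<f x} = {..<x}"
      proof
        show "g ` {i..<f x} \<subseteq> {..<x}"
        proof
          fix z assume "z \<in> g ` {i..<f x}"
          then obtain w where w: "i \<le> w" "w < f x" "z = g w" by auto
          hence "w \<in> {i..<m}" using fr[OF less.prems] by auto
          then obtain u where u: "u < k" "w = f u" using bij_betw_imp_surj_on[OF f(1)] by blast
          hence "u < x" using f(2) w less.prems by auto
          thus "z \<in> {..<x}" using less.IH u w by auto
        qed
        show "{..<x} \<subseteq> g ` {i..<f x}"
        proof
          fix u assume "u \<in> {..<x}"
          hence u: "u < x" "u < k" using less.prems by auto
          hence "f u \<in> {i..<f x}" using fr[of u] f(2)[of u x] less.prems by auto
          moreover have "g (f u) = u" using less.IH u by auto
          ultimately show "u \<in> g ` {i..<f x}" by force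
        qed
      qed
      moreover have "g ` {i..<f x} = {..<g (f x)}" using g(3) fr[OF less.prems] by auto
      ultimately show ?case by auto
    qed
    have "{..<g m} = g ` f ` {..<k}" using g(3)[OF im] f(1) by (auto simp: bij_betw_def)
    also have "\<dots> = {..<k}" using gf by force
    finally show ?thesis by auto
  qed
  have "is_concat (p |` {..<i}) q p"
    unfolding is_concat_def lr lq
  proof (intro conjI allI impI)
    show "dom p = {..<len p}" by (rule dp)
    show "ord_sum i b (len p)" using os[OF i] b_def by simp
    fix k m assume k: "k < b" and s: "ord_sum i k m"
    have im: "i \<le> m" using s unfolding ord_sum_def by simp
    have gm: "g m = k" using un[OF s] .
    have "m < len p"
    proof (rule ccontr)
      assume "\<not> m < len p"
      hence "b \<le> g m" using g(2)[OF i, of m] unfolding b_def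
        by (cases m "len p" rule: linorder_cases) auto
      thus False using gm k by auto
    qed
    thus "p m = q k" using q[OF im] gm by simp
  qed auto
  thus ?thesis using T p rS qS unfolding additive_tree_def by blast
qed

lemma additive_tree_extend:
  fixes T :: "('o::wellorder \<rightharpoonup> bool) set"
  assumes T: "additive_tree T \<alpha>" and p: "p \<in> T"
  shows "\<exists>r\<in>T. tree_less p r"
proof -
  let ?q = "[ord_zero \<mapsto> False] :: 'o \<rightharpoonup> bool"
  have sub: "T \<subseteq> simple_tree \<alpha>" and q: "?q \<in> T" using T unfolding additive_tree_def by auto
  then obtain r where r: "r \<in> T" "is_concat p ?q r"
    using T p unfolding additive_tree_def by blast
  note dp = simple_tree_dom[OF subsetD[OF sub p]] and dq = simple_tree_dom[OF subsetD[OF sub q]]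
  have "ord_zero \<in> dom ?q" by (simp add: domIff)
  from this[unfolded dq] have z: "ord_zero \<in> {..<len ?q}" .
  obtain f where "bij_betw f {..<len ?q} {len p..<len r}"
    using r(2) unfolding is_concat_def ord_sum_def order_isomorphic_def by (elim conjE exE)
  hence "f ord_zero \<in> {len p..<len r}" using z by (rule bij_betw_apply)
  hence "len p < len r" unfolding atLeastLessThan_iff by (elim conjE) (rule le_less_trans)
  hence "p \<noteq> r" by blast
  moreover have "r k = p k" if "k < len p" for k
    using r(2) that unfolding is_concat_def by simp
  hence "p \<subseteq>\<^sub>m r" unfolding map_le_def dp lessThan_iff by simp
  ultimately show ?thesis using r(1) unfolding tree_less_def by blast
qed

lemma len_branch:
  assumes T: "additive_tree T \<alpha>" and C: "pred_on.maxchain T tree_less C"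
    and x: "Map.graph x = (\<Union>p\<in>C. Map.graph p)"
  shows "dom x = {..<len x}" "order_isomorphic tree_less C (<) {..<len x}"
proof -
  have sub: "T \<subseteq> simple_tree \<alpha>" using T unfolding additive_tree_def by auto
  have CT: "C \<subseteq> T" using C unfolding pred_on.maxchain_def pred_on.chain_def by auto
  have dC: "dom p = {..<len p}" "len p < \<alpha>" if "p \<in> C" for p
    using simple_tree_dom[OF subsetD[OF sub subsetD[OF CT that]]]
      simple_tree_len[OF subsetD[OF sub subsetD[OF CT that]]] .
  have chain_iff: "pred_on.chain T tree_less S \<longleftrightarrow>
      S \<subseteq> T \<and> (\<forall>p\<in>S. \<forall>q\<in>S. p \<subseteq>\<^sub>m q \<or> q \<subseteq>\<^sub>m p)" for S
  proof -
    have "tree_less\<^sup>=\<^sup>= p q \<longleftrightarrow> p \<subseteq>\<^sub>m q" for p q :: "'a \<rightharpoonup> bool"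
      unfolding tree_less_def by (auto simp: map_le_refl)
    thus ?thesis unfolding pred_on.chain_def by simp
  qed
  have cmp: "p \<subseteq>\<^sub>m q \<or> q \<subseteq>\<^sub>m p" if "p \<in> C" "q \<in> C" for p q
    using that C unfolding pred_on.maxchain_def chain_iff by blast
  have ins: "r \<in> C" if "r \<in> T" "\<And>p. p \<in> C \<Longrightarrow> p \<subseteq>\<^sub>m r \<or> r \<subseteq>\<^sub>m p" for r
  proof (rule ccontr)
    assume "r \<notin> C"
    moreover have "pred_on.chain T tree_less (insert r C)"
      using that CT cmp unfolding chain_iff by (auto simp: map_le_refl)
    ultimately show False using C unfolding pred_on.maxchain_def by blast
  qed
  have le_len: "p \<subseteq>\<^sub>m q \<longleftrightarrow> len p \<le> len q" if "p \<in> C" "q \<in> C" for p q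
  proof -
    have "len p \<le> len q" if "p \<subseteq>\<^sub>m q" "p \<in> C" "q \<in> C" for p q
      using map_le_implies_dom_le[OF that(1)] dC[OF that(2)] dC[OF that(3)] by simp
    moreover have "p = q" if "q \<subseteq>\<^sub>m p" "len p \<le> len q" "p \<in> C" "q \<in> C" for p q
      using that dC(1)[OF that(3)] dC(1)[OF that(4)] calculation[OF that(1,4,3)]
      by (intro map_le_antisym) (auto simp: map_le_def)
    ultimately show ?thesis using cmp[OF that] that by (metis map_le_refl)
  qed
  have less_len: "tree_less p q \<longleftrightarrow> len p < len q" if "p \<in> C" "q \<in> C" for p q
    using le_len[OF that] le_len[OF that(2) that(1)] unfolding tree_less_def
    by (metis map_le_antisym map_le_refl not_le order.order_iff_strict)
  have down: "p |` {..<i} \<in> C" "len (p |` {..<i}) = i" if "p \<in> C" "i \<le> len p" for p i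
  proof -
    show "p |` {..<i} \<in> C"
    proof (rule ins)
      show "p |` {..<i} \<in> T" using additive_tree_restrict[OF T] that CT by auto
      fix q assume q: "q \<in> C"
      have "q \<subseteq>\<^sub>m p |` {..<i} \<or> p |` {..<i} \<subseteq>\<^sub>m q"
      proof (cases "len q \<le> i")
        case True
        hence "q \<subseteq>\<^sub>m p" using le_len[OF q that(1)] that by auto
        thus ?thesis using True dC(1)[OF q] by (auto simp: map_le_def restrict_map_def)
      next
        case False
        hence "\<forall>k<i. p k = q k"
          using cmp[OF q that(1)] dC(1)[OF q] dC(1)[OF that(1)] that(2)
          by (fastforce simp: map_le_def)
        thus ?thesis by (auto simp: map_le_def restrict_map_def)
      qed
      thus "q \<subseteq>\<^sub>m p |` {..<i} \<or> p |` {..<i} \<subseteq>\<^sub>m q" .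
    qed
    show "len (p |` {..<i}) = i" by (rule len_eqI) (use dC(1)[OF that(1)] that(2) in auto)
  qed
  have up: "\<exists>q\<in>C. len p < len q" if "p \<in> C" for p
  proof (rule ccontr)
    assume "\<not> ?thesis"
    hence top: "q \<subseteq>\<^sub>m p" if "q \<in> C" for q using le_len[OF that \<open>p \<in> C\<close>] that by (auto simp: not_less)
    obtain r where r: "r \<in> T" "tree_less p r" using additive_tree_extend[OF T subsetD[OF CT \<open>p \<in> C\<close>]] by blast
    hence "r \<in> C" using top map_le_trans unfolding tree_less_def by (intro ins) blast+
    hence "r \<subseteq>\<^sub>m p" by (rule top)
    thus False using r unfolding tree_less_def by (auto dest: map_le_antisym)
  qed
  have "dom x = fst ` Map.graph x" by (auto simp: graph_def image_iff dom_def)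
  also have "\<dots> = (\<Union>p\<in>C. dom p)" unfolding x by (force simp: graph_def image_iff dom_def)
  also have "\<dots> = (\<Union>p\<in>C. {..<len p})" using dC by simp
  finally have dx: "dom x = (\<Union>p\<in>C. {..<len p})" .
  define h where "h = (LEAST k. k \<notin> dom x)"
  have "\<alpha> \<notin> dom x" using dx dC(2) by (metis UN_E lessThan_iff less_asym)
  hence h: "h \<notin> dom x" unfolding h_def by (rule LeastI)
  have dh: "dom x = {..<h}"
  proof
    show "{..<h} \<subseteq> dom x" using not_less_Least unfolding h_def by blast
    show "dom x \<subseteq> {..<h}"
    proof
      fix k assume "k \<in> dom x"
      then obtain p where "p \<in> C" "k < len p" unfolding dx by blast
      hence "h \<le> k \<Longrightarrow> h \<in> dom x" unfolding dx by (auto intro: le_less_trans)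
      thus "k \<in> {..<h}" using h by (auto simp: not_le[symmetric])
    qed
  qed
  from dh have lx: "len x = h" by (rule len_eqI)
  show "dom x = {..<len x}" using dh lx by simp
  have "bij_betw len C {..<h}"
    unfolding bij_betw_def
  proof
    show "inj_on len C" using le_len by (intro inj_onI) (metis map_le_antisym order_refl)
    show "len ` C = {..<h}"
    proof
      show "len ` C \<subseteq> {..<h}" using up unfolding dh[symmetric] dx by blast
      show "{..<h} \<subseteq> len ` C"
      proof
        fix k assume "k \<in> {..<h}"
        then obtain p where "p \<in> C" "k < len p" unfolding dh[symmetric] dx by blast
        thus "k \<in> len ` C" using down[of p k] by (metis imageI less_imp_le)
      qed
    qed
  qed
  thus "order_isomorphic tree_less C (<) {..<len x}"
    unfolding order_isomorphic_def lx using less_len by blast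
qed

end

theory Submission
  imports Defs
begin

text \<open>For \<open>p \<in> T\<close> the branches extending \<open>p\<close> form a copy \<open>p + X\<close> of the branch space \<open>X\<close>.
  Lexicographic suprema can be read off digit by digit, whence compactness, and the jumps
  \<open>q0111\<dots> < q1000\<dots>\<close> of the order provide clopen cuts between any two branches.

  The main point is that the final segment starting at the right end of such a jump is isomorphic to
  \<open>X\<close>: it is the sum of \<open>q1 + X\<close> and of one copy of \<open>X\<close> for every place at which a branch can pass \<open>q\<close> on
  the right.  If \<open>\<beta>\<close> is the order type of the set of these places, then \<open>X\<close> itself is the sum of
  \<open>0\<^sup>\<beta> + X\<close> and of the copies \<open>0\<^sup>j1 + X\<close> for \<open>j < \<beta>\<close>, and these match.  A clopen interval splits into an end of
  \<open>s0 + X\<close> and an end of \<open>s1 + X\<close>, as \<open>X\<close> splits into \<open>0 + X\<close> and \<open>1 + X\<close>.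

  If \<open>\<alpha>\<close> is countable then \<open>X\<close> is first countable, and the complement of every point is the disjoint
  union of a sequence of clopen sets isomorphic to \<open>X\<close> which converges to the point.\<close>

section \<open>Order isomorphisms\<close>

text \<open>The two hypotheses on heights do different work. Since \<beta> + \<alpha> = \<alpha> for
  \<beta> < \<alpha>, prefixing a vertex never pushes a branch beyond height \<alpha>, so p + X fits
  inside X. Since both constant branches have height \<alpha>, every constant word shorter than
  \<alpha> is a vertex and the constant words of length \<alpha> are branches: the former yield the
  vertices coding the exits from q, whose order type is at most the height of q and hence below
  \<alpha>; the latter yield the end points of jumps.

  Two obstacles shape the rest. Sums of ordinals may fail to exist in an arbitrary well-ordered
  type, so concatenation is phrased by left subtraction, which always exists. And the cylinder p + X
  need not be open when p has limit length, because its end points may be limits of branches that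
  leave p earlier. Hence the clopen sets are built from cuts at jumps, and cylinders serve only as
  summands. Conversely, compactness shows that a clopen interval can end only at a jump or at an end
  of X, which brings every clopen interval back to cuts.\<close>

lemma order_isomorphic_sym:
  assumes "order_isomorphic R A S B"
  shows "order_isomorphic S B R A"
proof -
  obtain f where f: "bij_betw f A B" "\<And>x y. x \<in> A \<Longrightarrow> y \<in> A \<Longrightarrow> R x y \<longleftrightarrow> S (f x) (f y)"
    using assms unfolding order_isomorphic_def by blast
  have "bij_betw (inv_into A f) B A"
    using f(1) by (rule bij_betw_inv_into)
  moreover have "S x y \<longleftrightarrow> R (inv_into A f x) (inv_into A f y)" if "x \<in> B" "y \<in> B" for x y
    using that f by (metis bij_betw_imp_surj_on f_inv_into_f inv_into_into)
  ultimately show ?thesis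
    unfolding order_isomorphic_def by blast
qed

lemma order_isomorphic_trans [trans]:
  assumes "order_isomorphic R A S B" "order_isomorphic S B Q C"
  shows "order_isomorphic R A Q C"
proof -
  obtain f where f: "bij_betw f A B" "\<And>x y. x \<in> A \<Longrightarrow> y \<in> A \<Longrightarrow> R x y \<longleftrightarrow> S (f x) (f y)"
    using assms unfolding order_isomorphic_def by blast
  obtain g where g: "bij_betw g B C" "\<And>x y. x \<in> B \<Longrightarrow> y \<in> B \<Longrightarrow> S x y \<longleftrightarrow> Q (g x) (g y)"
    using assms unfolding order_isomorphic_def by blast
  have "bij_betw (g \<circ> f) A C"
    using f(1) g(1) by (rule bij_betw_trans)
  moreover have "R x y \<longleftrightarrow> Q ((g \<circ> f) x) ((g \<circ> f) y)" if "x \<in> A" "y \<in> A" for x y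
    using that f g by (simp add: bij_betw_apply)
  ultimately show ?thesis
    unfolding order_isomorphic_def by blast
qed

lemma order_isomorphic_converse:
  "order_isomorphic (\<lambda>x y. R y x) A (\<lambda>x y. S y x) B \<longleftrightarrow> order_isomorphic R A S B"
  unfolding order_isomorphic_def by blast

lemma order_isomorphic_cong:
  assumes "\<And>x y. x \<in> A \<Longrightarrow> y \<in> A \<Longrightarrow> R x y \<longleftrightarrow> R' x y"
    and "\<And>x y. x \<in> B \<Longrightarrow> y \<in> B \<Longrightarrow> S x y \<longleftrightarrow> S' x y"
  shows "order_isomorphic R A S B \<longleftrightarrow> order_isomorphic R' A S' B"
proof -
  have "bij_betw f A B \<Longrightarrow> (\<forall>x\<in>A. \<forall>y\<in>A. R x y \<longleftrightarrow> S (f x) (f y)) \<longleftrightarrow>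
      (\<forall>x\<in>A. \<forall>y\<in>A. R' x y \<longleftrightarrow> S' (f x) (f y))" for f
    using assms by (simp add: bij_betw_apply)
  thus ?thesis
    unfolding order_isomorphic_def by blast
qed

text \<open>Ordered sums of isomorphic summands are isomorphic. The strict separation of summands,
  with its negated half, also makes them disjoint, so each point determines its index and the chosen
  isomorphisms can be glued without order axioms on \<open>R\<close> and \<open>S\<close>.\<close>

lemma order_isomorphic_UN:
  fixes I :: "'i::linorder set"
  assumes iso: "\<And>i. i \<in> I \<Longrightarrow> order_isomorphic R (A i) S (B i)"
    and A: "\<And>i j x y. i \<in> I \<Longrightarrow> j \<in> I \<Longrightarrow> i < j \<Longrightarrow> x \<in> A i \<Longrightarrow> y \<in> A j \<Longrightarrow> R x y \<and> \<not> R y x"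
    and B: "\<And>i j x y. i \<in> I \<Longrightarrow> j \<in> I \<Longrightarrow> i < j \<Longrightarrow> x \<in> B i \<Longrightarrow> y \<in> B j \<Longrightarrow> S x y \<and> \<not> S y x"
  shows "order_isomorphic R (\<Union>i\<in>I. A i) S (\<Union>i\<in>I. B i)"
proof -
  obtain f where bij: "\<And>i. i \<in> I \<Longrightarrow> bij_betw (f i) (A i) (B i)"
    and ord: "\<And>i x y. i \<in> I \<Longrightarrow> x \<in> A i \<Longrightarrow> y \<in> A i \<Longrightarrow> R x y \<longleftrightarrow> S (f i x) (f i y)"
    using iso unfolding order_isomorphic_def by metis
  define ix where "ix x = (THE i. i \<in> I \<and> x \<in> A i)" for x
  have uniq: "i = j" if "i \<in> I" "j \<in> I" "x \<in> A i" "x \<in> A j" for i j x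
    using A[of i j x x] A[of j i x x] that by (cases i j rule: linorder_cases) auto
  have ix: "ix x = i" if "i \<in> I" "x \<in> A i" for i x
    unfolding ix_def using that uniq by blast
  let ?f = "\<lambda>x. f (ix x) x"
  have f: "?f x = f i x" "f i x \<in> B i" if "i \<in> I" "x \<in> A i" for i x
    using ix[OF that] bij_betw_apply[OF bij[OF that(1)] that(2)] by auto
  have lt: "R x y \<longleftrightarrow> S (?f x) (?f y)" "?f x = ?f y \<Longrightarrow> x = y"
    if x: "i \<in> I" "x \<in> A i" and y: "j \<in> I" "y \<in> A j" for i j x y
  proof -
    consider "i < j" | "i = j" | "j < i" by fastforce
    hence "(R x y \<longleftrightarrow> S (?f x) (?f y)) \<and> (?f x = ?f y \<longrightarrow> x = y)"
    proof cases
      case 1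
      have S: "S (f i x) (f j y) \<and> \<not> S (f j y) (f i x)"
        using B[OF x(1) y(1) 1 f(2)[OF x] f(2)[OF y]] .
      show ?thesis
        using A[OF x(1) y(1) 1 x(2) y(2)] S f(1)[OF x] f(1)[OF y] by metis
    next
      case 2
      have "inj_on (f i) (A i)" using bij[OF x(1)] by (simp add: bij_betw_def)
      thus ?thesis
        using ord[OF x(1)] x y f(1)[OF x] f(1)[OF y] 2 by (metis inj_onD)
    next
      case 3
      have S: "S (f j y) (f i x) \<and> \<not> S (f i x) (f j y)"
        using B[OF y(1) x(1) 3 f(2)[OF y] f(2)[OF x]] .
      show ?thesis
        using A[OF y(1) x(1) 3 y(2) x(2)] S f(1)[OF x] f(1)[OF y] by metis
    qed
    thus "R x y \<longleftrightarrow> S (?f x) (?f y)" "?f x = ?f y \<Longrightarrow> x = y" by auto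
  qed
  have "?f ` (\<Union>i\<in>I. A i) = (\<Union>i\<in>I. B i)"
  proof -
    have "?f ` (\<Union>i\<in>I. A i) = (\<Union>i\<in>I. ?f ` A i)" by blast
    also have "\<dots> = (\<Union>i\<in>I. f i ` A i)" using f(1) by (intro SUP_cong image_cong refl)
    also have "\<dots> = (\<Union>i\<in>I. B i)" using bij by (simp add: bij_betw_def)
    finally show ?thesis .
  qed
  moreover have "inj_on ?f (\<Union>i\<in>I. A i)"
    using lt(2) by (intro inj_onI) blast
  ultimately have "bij_betw ?f (\<Union>i\<in>I. A i) (\<Union>i\<in>I. B i)"
    by (simp add: bij_betw_def)
  thus ?thesis
    unfolding order_isomorphic_def using lt(1) by (intro exI[of _ ?f]) blast
qed

lemma order_isomorphic_Un:
  assumes "order_isomorphic R A S B" "order_isomorphic R A' S B'"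
    and "\<And>x y. x \<in> A \<Longrightarrow> y \<in> A' \<Longrightarrow> R x y \<and> \<not> R y x"
    and "\<And>x y. x \<in> B \<Longrightarrow> y \<in> B' \<Longrightarrow> S x y \<and> \<not> S y x"
  shows "order_isomorphic R (A \<union> A') S (B \<union> B')"
proof -
  have "order_isomorphic R (\<Union>i\<in>UNIV. if i then A' else A) S (\<Union>i\<in>UNIV. if i then B' else B)"
    by (rule order_isomorphic_UN) (use assms in \<open>auto split: if_splits\<close>)
  thus ?thesis by (simp add: UNIV_bool Un_commute)
qed


section \<open>Linearly ordered topological spaces\<close>

locale lots_space =
  fixes X :: "'a set" and r :: "'a rel"
  assumes lots: "lots X r"
begin

abbreviation \<tau> :: "'a topology" where "\<tau> \<equiv> lots_topology X r"

lemma less_in: "(x, y) \<in> r \<Longrightarrow> x \<in> X \<and> y \<in> X"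
  using lots unfolding lots_def by auto

lemma less_trans: "(x, y) \<in> r \<Longrightarrow> (y, z) \<in> r \<Longrightarrow> (x, z) \<in> r"
  using lots unfolding lots_def strict_linear_order_on_def by (blast dest: transD)

lemma less_irrefl: "(x, x) \<notin> r"
  using lots unfolding lots_def strict_linear_order_on_def irrefl_def by blast

lemma less_asym: "(x, y) \<in> r \<Longrightarrow> (y, x) \<notin> r"
  using less_trans less_irrefl by blast

lemma less_total: "x \<in> X \<Longrightarrow> y \<in> X \<Longrightarrow> x \<noteq> y \<Longrightarrow> (x, y) \<in> r \<or> (y, x) \<in> r"
  using lots unfolding lots_def strict_linear_order_on_def total_on_def by blast

lemma lots_converse: "lots X (r\<inverse>)"
  using lots unfolding lots_def strict_linear_order_on_def by (auto simp: irrefl_def)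

text \<open>The subbase of rays is symmetric. Interpreting the locale for \<open>r\<inverse>\<close>
  therefore gives minima, successors and lower rays from the corresponding facts about maxima,
  predecessors and upper rays.\<close>

lemma lots_topology_converse: "lots_topology X (r\<inverse>) = \<tau>"
  unfolding lots_topology_def by (simp add: Un_commute)

lemma topspace_lots [simp]: "topspace \<tau> = X"
  unfolding lots_topology_def by auto

lemma openin_above: "a \<in> X \<Longrightarrow> openin \<tau> {x \<in> X. (a, x) \<in> r}"
  and openin_below: "a \<in> X \<Longrightarrow> openin \<tau> {x \<in> X. (x, a) \<in> r}"
  unfolding lots_topology_def by (rule topology_generated_by_Basis; blast)+

lemma openin_lots_induct [consumes 1, case_names whole above below Int Union]:
  assumes "openin \<tau> U"
    and "P X"
    and "\<And>a. a \<in> X \<Longrightarrow> P {x \<in> X. (a, x) \<in> r}"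
    and "\<And>a. a \<in> X \<Longrightarrow> P {x \<in> X. (x, a) \<in> r}"
    and "\<And>U V. P U \<Longrightarrow> P V \<Longrightarrow> P (U \<inter> V)"
    and "\<And>\<U>. (\<And>U. U \<in> \<U> \<Longrightarrow> P U) \<Longrightarrow> P (\<Union>\<U>)"
  shows "P U"
proof -
  have "generate_topology_on
      (insert X ((\<lambda>a. {x \<in> X. (a, x) \<in> r}) ` X \<union> (\<lambda>a. {x \<in> X. (x, a) \<in> r}) ` X)) U"
    using assms(1) unfolding lots_topology_def by (rule openin_topology_generated_by)
  thus ?thesis
  proof (induction rule: generate_topology_on.induct)
    case Empty
    show ?case using assms(6)[of "{}"] by simp
  qed (use assms in auto)
qed

lemma closedin_singleton: "x \<in> X \<Longrightarrow> closedin \<tau> {x}"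
proof -
  assume x: "x \<in> X"
  have "X - {x} = {y \<in> X. (x, y) \<in> r} \<union> {y \<in> X. (y, x) \<in> r}"
    using x less_total less_irrefl by auto
  thus ?thesis
    using x openin_above openin_below by (simp add: closedin_def openin_Un)
qed

text \<open>By Alexander's subbase theorem only covers by rays matter. Let c be the supremum of the
  end points of the lower rays in the cover. No lower ray of the cover contains c, so c is covered
  by X or by an upper ray from some a < c; then some lower ray of the cover ends beyond a, and the
  two rays cover X. The empty S is allowed, so X has a least point.\<close>

lemma compact_space_if_sup:
  assumes sup: "\<And>S. S \<subseteq> X \<Longrightarrow> \<exists>c\<in>X. (\<forall>s\<in>S. (c, s) \<notin> r) \<and> (\<forall>z. (z, c) \<in> r \<longrightarrow> (\<exists>s\<in>S. (z, s) \<in> r))"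
  shows "compact_space \<tau>"
proof -
  let ?B = "insert X ((\<lambda>a. {x \<in> X. (a, x) \<in> r}) ` X \<union> (\<lambda>a. {x \<in> X. (x, a) \<in> r}) ` X)"
  show ?thesis
  proof (rule Alexander_subbase_alt[where U = X and \<B> = ?B])
    show "X \<subseteq> \<Union>?B" by auto
  next
    fix C assume C: "C \<subseteq> ?B" "X \<subseteq> \<Union>C"
    define S where "S = {b \<in> X. {x \<in> X. (x, b) \<in> r} \<in> C}"
    obtain c where c: "c \<in> X" "\<forall>s\<in>S. (c, s) \<notin> r" "\<And>z. (z, c) \<in> r \<Longrightarrow> \<exists>s\<in>S. (z, s) \<in> r"
      using sup[of S] unfolding S_def by blast
    obtain V where V: "V \<in> C" "c \<in> V" using C(2) c(1) by blast
    consider "V = X" | a where "a \<in> X" "V = {x \<in> X. (a, x) \<in> r}"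
      | b where "b \<in> X" "V = {x \<in> X. (x, b) \<in> r}"
      using V(1) C(1) by blast
    thus "\<exists>C'. finite C' \<and> C' \<subseteq> C \<and> X \<subseteq> \<Union>C'"
    proof cases
      case 1
      thus ?thesis using V by (intro exI[of _ "{V}"]) auto
    next
      case 2
      then obtain b where b: "b \<in> S" "(a, b) \<in> r" using c(3) V(2) by blast
      have "X \<subseteq> V \<union> {x \<in> X. (x, b) \<in> r}"
        using b less_total less_trans 2 less_in by blast
      thus ?thesis
        using V(1) b(1) unfolding S_def by (intro exI[of _ "{V, {x \<in> X. (x, b) \<in> r}}"]) auto
    next
      case 3
      hence "b \<in> S" using V(1) unfolding S_def by auto
      thus ?thesis using c(2) V(2) 3 by auto
    qed
  next
    \<comment> \<open>The subbase theorem uses finite intersections relative to X. Agreement with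
      the generated topology is checked by minimality in one direction and on the rays in the
      other.\<close>
    show "topology (arbitrary union_of (finite intersection_of (\<lambda>x. x \<in> ?B) relative_to X)) = \<tau>"
      (is "?\<sigma> = _")
    proof (rule topology_eq[THEN iffD2], intro allI iffI)
      fix U assume "openin ?\<sigma> U"
      thus "openin \<tau> U"
        by (rule minimal_topology_subbase[rotated 2])
          (use openin_above openin_below openin_topspace[of \<tau>] in auto)
    next
      have sub: "openin ?\<sigma> (X \<inter> V)" if "V \<in> ?B" for V
        unfolding openin_subbase using that
        by (intro arbitrary_union_of_inc relative_to_inc finite_intersection_of_inc)
      fix U assume "openin \<tau> U"
      thus "openin ?\<sigma> U"
      proof (induction rule: openin_lots_induct)
        case whole
        show ?case using openin_topspace[of ?\<sigma>] unfolding topspace_subbase .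
      next
        case (above a)
        thus ?case using sub[of "{x \<in> X. (a, x) \<in> r}"] by (simp add: Int_absorb1)
      next
        case (below a)
        thus ?case using sub[of "{x \<in> X. (x, a) \<in> r}"] by (simp add: Int_absorb1)
      qed (blast intro: openin_Int openin_Union)+
    qed
  qed
qed

text \<open>Without a maximum the lower rays ending at points of S would cover S; the largest end
  point in a finite subcover would then be left uncovered.\<close>

lemma closed_has_max:
  assumes comp: "compact_space \<tau>" and S: "closedin \<tau> S" "S \<noteq> {}"
  shows "\<exists>m\<in>S. \<forall>s\<in>S. s = m \<or> (s, m) \<in> r"
proof (rule ccontr)
  assume no: "\<not> ?thesis"
  have SX: "S \<subseteq> X" using S(1) closedin_subset by fastforce
  have ex: "\<exists>t\<in>S. (s, t) \<in> r" if "s \<in> S" for s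
    using no that less_total SX by blast
  have "compactin \<tau> S" using comp S(1) by (rule closedin_compact_space)
  moreover have "\<forall>U\<in>(\<lambda>t. {x \<in> X. (x, t) \<in> r}) ` S. openin \<tau> U" using SX openin_below by auto
  moreover have "S \<subseteq> \<Union>((\<lambda>t. {x \<in> X. (x, t) \<in> r}) ` S)" using ex SX by auto
  ultimately obtain F where F: "finite F" "F \<subseteq> (\<lambda>t. {x \<in> X. (x, t) \<in> r}) ` S" "S \<subseteq> \<Union>F"
    unfolding compactin_def by meson
  from finite_subset_image[OF F(1,2)]
  obtain T where T: "T \<subseteq> S" "finite T" "F = (\<lambda>t. {x \<in> X. (x, t) \<in> r}) ` T" by blast
  have "T \<noteq> {}" using S(2) F(3) T(3) by auto
  have "\<exists>m\<in>T. \<forall>t\<in>T. t = m \<or> (t, m) \<in> r"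
    using \<open>finite T\<close> \<open>T \<noteq> {}\<close> T(1)
  proof (induction rule: finite_ne_induct)
    case (insert t T)
    then obtain m where m: "m \<in> T" "\<And>t. t \<in> T \<Longrightarrow> t = m \<or> (t, m) \<in> r" by auto
    consider "t = m" | "(t, m) \<in> r" | "(m, t) \<in> r"
      using less_total m(1) insert.prems SX by blast
    thus ?case
    proof cases
      case 3
      hence "\<forall>u\<in>insert t T. u = t \<or> (u, t) \<in> r" using m(2) less_trans by blast
      thus ?thesis by blast
    qed (use m in blast)+
  qed auto
  then obtain m where m: "m \<in> T" "\<And>t. t \<in> T \<Longrightarrow> t = m \<or> (t, m) \<in> r" by blast
  obtain t where "t \<in> T" "(m, t) \<in> r" using m(1) T F(3) by blast
  thus False using m(2) less_asym less_irrefl by blast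
qed

lemma closed_has_min:
  assumes comp: "compact_space \<tau>" and S: "closedin \<tau> S" "S \<noteq> {}"
  shows "\<exists>m\<in>S. \<forall>s\<in>S. s = m \<or> (m, s) \<in> r"
proof -
  interpret c: lots_space X "r\<inverse>" by unfold_locales (rule lots_converse)
  show ?thesis using c.closed_has_max[unfolded lots_topology_converse, OF assms] by simp
qed

lemma order_bounded_if_compact:
  assumes "compact_space \<tau>" "J \<subseteq> X" "J \<noteq> {}"
  shows "order_bounded X r J"
proof -
  have "closedin \<tau> X" using closedin_topspace[of \<tau>] by simp
  moreover have "X \<noteq> {}" using assms by auto
  ultimately obtain a b where ab: "a \<in> X" "\<forall>s\<in>X. s = a \<or> (a, s) \<in> r"
      "b \<in> X" "\<forall>s\<in>X. s = b \<or> (s, b) \<in> r"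
    using closed_has_max[OF assms(1), of X] closed_has_min[OF assms(1), of X] by meson
  have "\<forall>x\<in>J. (a, x) \<in> r\<^sup>= \<and> (x, b) \<in> r\<^sup>="
    using ab(2,4) assms(2) by auto
  thus ?thesis unfolding order_bounded_def by (intro bexI[OF _ ab(1)] bexI[OF _ ab(3)])
qed

lemma clopen_convex_Int:
  assumes "clopen_convex X r J" "clopen_convex X r K"
  shows "clopen_convex X r (J \<inter> K)"
proof -
  have "order_convex X r (J \<inter> K)"
    using assms unfolding clopen_convex_def order_convex_def by blast
  thus ?thesis
    using assms unfolding clopen_convex_def by (simp add: openin_Int closedin_Int)
qed

lemma clopen_convex_whole: "clopen_convex X r X"
  using openin_topspace[of \<tau>] closedin_topspace[of \<tau>]
  unfolding clopen_convex_def order_convex_def by simp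

text \<open>As J is open, so is the final segment starting at a; the set of points below a is then
  closed and has a maximum by compactness. Thus clopen intervals begin at jumps.\<close>

lemma predecessor_of_min:
  assumes comp: "compact_space \<tau>" and J: "clopen_convex X r J"
    and a: "a \<in> J" "\<And>y. y \<in> J \<Longrightarrow> y = a \<or> (a, y) \<in> r" and z: "z \<in> X" "(z, a) \<in> r"
  shows "\<exists>w\<in>X. (w, a) \<in> r \<and> (\<forall>y\<in>X. (y, a) \<in> r \<longrightarrow> y = w \<or> (y, w) \<in> r)"
proof -
  let ?S = "{y \<in> X. (y, a) \<in> r}"
  have aX: "a \<in> X" using z less_in by blast
  have "J \<union> {y \<in> X. (a, y) \<in> r} = X - ?S"
    using a J less_total aX less_asym less_irrefl
    unfolding clopen_convex_def order_convex_def by blast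
  moreover have "openin \<tau> (J \<union> {y \<in> X. (a, y) \<in> r})"
    using J openin_above[OF aX] unfolding clopen_convex_def by (simp add: openin_Un)
  ultimately have "closedin \<tau> ?S" by (simp add: closedin_def)
  moreover have "?S \<noteq> {}" using z by auto
  ultimately obtain w where "w \<in> ?S" "\<forall>y\<in>?S. y = w \<or> (y, w) \<in> r"
    using closed_has_max[OF comp] by meson
  thus ?thesis by auto
qed

lemma clopen_convex_converse: "clopen_convex X (r\<inverse>) J \<longleftrightarrow> clopen_convex X r J"
  unfolding clopen_convex_def order_convex_def lots_topology_converse by blast

lemma successor_of_max:
  assumes comp: "compact_space \<tau>" and J: "clopen_convex X r J"
    and a: "a \<in> J" "\<And>y. y \<in> J \<Longrightarrow> y = a \<or> (y, a) \<in> r" and z: "z \<in> X" "(a, z) \<in> r"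
  shows "\<exists>w\<in>X. (a, w) \<in> r \<and> (\<forall>y\<in>X. (a, y) \<in> r \<longrightarrow> y = w \<or> (w, y) \<in> r)"
proof -
  interpret c: lots_space X "r\<inverse>" by unfold_locales (rule lots_converse)
  show ?thesis
    using c.predecessor_of_min[unfolded lots_topology_converse clopen_convex_converse, OF comp J a(1) _ z(1)]
      a(2) z(2) by simp
qed

section \<open>Continuity of order isomorphisms between closed sets\<close>

lemma continuous_map_into_lots:
  assumes "f ` topspace U \<subseteq> X"
    and "\<And>a. a \<in> X \<Longrightarrow> openin U {x \<in> topspace U. (a, f x) \<in> r}"
    and "\<And>a. a \<in> X \<Longrightarrow> openin U {x \<in> topspace U. (f x, a) \<in> r}"
  shows "continuous_map U \<tau> f"
  unfolding lots_topology_def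
proof (rule continuous_on_generated_topo)
  fix V
  assume "V \<in> insert X ((\<lambda>a. {x \<in> X. (a, x) \<in> r}) ` X \<union> (\<lambda>a. {x \<in> X. (x, a) \<in> r}) ` X)"
  then consider "V = X" | a where "a \<in> X" "V = {x \<in> X. (a, x) \<in> r}"
    | a where "a \<in> X" "V = {x \<in> X. (x, a) \<in> r}" by blast
  thus "openin U (f -` V \<inter> topspace U)"
  proof cases
    case 1
    hence "f -` V \<inter> topspace U = topspace U" using assms(1) by blast
    thus ?thesis by simp
  next
    case 2
    hence "f -` V \<inter> topspace U = {x \<in> topspace U. (a, f x) \<in> r}" using assms(1) by blast
    thus ?thesis using assms(2) 2 by simp
  next
    case 3
    hence "f -` V \<inter> topspace U = {x \<in> topspace U. (f x, a) \<in> r}" using assms(1) by blast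
    thus ?thesis using assms(3) 3 by simp
  qed
qed (use assms(1) in auto)

text \<open>The sets C and D need not be convex and a need not lie in D. The ray from a is therefore
  replaced by the ray from the greatest point m of D that is not above a; its preimage is the trace
  on C of a ray from the preimage of m.\<close>

lemma openin_order_iso_above:
  assumes comp: "compact_space \<tau>" and C: "closedin \<tau> C" and D: "closedin \<tau> D"
    and f: "bij_betw f C D" "\<And>x y. x \<in> C \<Longrightarrow> y \<in> C \<Longrightarrow> (x, y) \<in> r \<longleftrightarrow> (f x, f y) \<in> r"
    and a: "a \<in> X"
  shows "openin (subtopology \<tau> C) {x \<in> C. (a, f x) \<in> r}"
proof -
  have CX: "C \<subseteq> X" using closedin_subset[OF C] by simp
  have DX: "D \<subseteq> X" using closedin_subset[OF D] by simp
  have fD: "f x \<in> D" if "x \<in> C" for x using f(1) that by (rule bij_betw_apply)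
  let ?S = "D - {y \<in> X. (a, y) \<in> r}"
  have S: "closedin \<tau> ?S" using D openin_above[OF a] by (rule closedin_diff)
  show ?thesis
  proof (cases "?S = {}")
    case True
    hence "{x \<in> C. (a, f x) \<in> r} = topspace (subtopology \<tau> C)" using fD CX by auto
    thus ?thesis by (simp only: openin_topspace)
  next
    case False
    then obtain m where m: "m \<in> ?S" "\<forall>s\<in>?S. s = m \<or> (s, m) \<in> r"
      using closed_has_max[OF comp S] by meson
    obtain c where c: "c \<in> C" "m = f c" using f(1) m(1) unfolding bij_betw_def by blast
    have m': "m \<in> X" "(a, m) \<notin> r" using m(1) DX by auto
    have "(a, f x) \<in> r \<longleftrightarrow> (c, x) \<in> r" if x: "x \<in> C" for x
    proof -
      have fx: "f x \<in> D" "f x \<in> X" using fD[OF x] DX by auto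
      have "(a, f x) \<in> r \<longleftrightarrow> (m, f x) \<in> r"
      proof
        assume "(a, f x) \<in> r"
        thus "(m, f x) \<in> r" using m' less_total[of m a] less_trans a by metis
      next
        assume "(m, f x) \<in> r"
        hence "f x \<notin> ?S" using m(2) less_asym less_irrefl by metis
        thus "(a, f x) \<in> r" using fx by simp
      qed
      thus ?thesis using f(2)[OF c(1) x] c(2) by simp
    qed
    hence "{x \<in> C. (a, f x) \<in> r} = C \<inter> {x \<in> X. (c, x) \<in> r}" using CX by auto
    thus ?thesis using openin_above[of c] c CX by (simp add: openin_subtopology_Int2 subsetD)
  qed
qed

lemma continuous_map_order_iso:
  assumes comp: "compact_space \<tau>" and C: "closedin \<tau> C" and D: "closedin \<tau> D"
    and f: "bij_betw f C D" "\<And>x y. x \<in> C \<Longrightarrow> y \<in> C \<Longrightarrow> (x, y) \<in> r \<longleftrightarrow> (f x, f y) \<in> r"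
  shows "continuous_map (subtopology \<tau> C) \<tau> f"
proof (rule continuous_map_into_lots)
  interpret c: lots_space X "r\<inverse>" by unfold_locales (rule lots_converse)
  have ts: "topspace (subtopology \<tau> C) = C" using closedin_subset[OF C] by auto
  show "f ` topspace (subtopology \<tau> C) \<subseteq> X"
    using f(1) closedin_subset[OF D] unfolding ts bij_betw_def by auto
  fix a assume a: "a \<in> X"
  show "openin (subtopology \<tau> C) {x \<in> topspace (subtopology \<tau> C). (a, f x) \<in> r}"
    unfolding ts by (rule openin_order_iso_above[OF assms a])
  show "openin (subtopology \<tau> C) {x \<in> topspace (subtopology \<tau> C). (f x, a) \<in> r}"
    using c.openin_order_iso_above[unfolded lots_topology_converse, OF comp C D f(1) _ a] f(2)
    unfolding ts by simp
qed

subsection \<open>Homogeneity of first-countable spaces with isomorphic clopen intervals\<close>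

lemma clopen_convex_subset: "clopen_convex X r J \<Longrightarrow> J \<subseteq> X"
  unfolding clopen_convex_def order_convex_def by simp

lemma perfect_other_point:
  assumes "perfect_lots X r" "openin \<tau> U" "x \<in> U"
  obtains z where "z \<in> U" "z \<noteq> x"
proof -
  have "x \<in> X" using assms openin_subset topspace_lots by blast
  hence "U \<noteq> {x}" using assms unfolding perfect_lots_def by blast
  thus ?thesis using that assms(3) by blast
qed

lemma Hausdorff_if_zero_dimensional:
  assumes zd: "zero_dimensional_lots X r"
  shows "Hausdorff_space \<tau>"
  unfolding Hausdorff_space_def
proof (intro allI impI, elim conjE)
  fix x y assume xy: "x \<in> topspace \<tau>" "y \<in> topspace \<tau>" "x \<noteq> y"
  have "openin \<tau> (X - {y})"
    using closedin_singleton[of y] xy(2) by (simp add: closedin_def)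
  moreover have "x \<in> X - {y}" using xy by simp
  ultimately obtain J where J: "clopen_convex X r J" "x \<in> J" "J \<subseteq> X - {y}"
    using zd unfolding zero_dimensional_lots_def by meson
  have "openin \<tau> J" "openin \<tau> (X - J)"
    using J(1) unfolding clopen_convex_def by (simp_all add: closedin_def)
  thus "\<exists>U V. openin \<tau> U \<and> openin \<tau> V \<and> x \<in> U \<and> y \<in> V \<and> disjnt U V"
    using J xy(2) by (intro exI[of _ J] exI[of _ "X - J"]) (auto simp: disjnt_def)
qed

text \<open>Starting with the whole space makes the successive differences exhaust the complement of
  x, and strict inclusion makes each of them nonempty.\<close>

lemma shrinking_clopen_neighbourhoods:
  assumes zd: "zero_dimensional_lots X r" and perf: "perfect_lots X r"
    and fc: "first_countable \<tau>" and x: "x \<in> X"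
  obtains J :: "nat \<Rightarrow> 'a set" where "J 0 = X" "\<And>n. clopen_convex X r (J n)" "\<And>n. x \<in> J n"
    "\<And>n. J (Suc n) \<subset> J n" "\<And>U. openin \<tau> U \<Longrightarrow> x \<in> U \<Longrightarrow> \<exists>n. J n \<subseteq> U"
proof -
  obtain B where B: "countable B" "\<And>V. V \<in> B \<Longrightarrow> openin \<tau> V"
      "\<And>U. openin \<tau> U \<Longrightarrow> x \<in> U \<Longrightarrow> \<exists>V\<in>B. x \<in> V \<and> V \<subseteq> U"
    using fc x unfolding first_countable_def by (metis topspace_lots)
  define V where "V n = (if x \<in> from_nat_into B n then from_nat_into B n else X)" for n
  have "B \<noteq> {}" using B(3)[of X] openin_topspace[of \<tau>] x by auto
  hence V: "openin \<tau> (V n)" "x \<in> V n" for n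
    unfolding V_def using B(2)[OF from_nat_into] x openin_topspace[of \<tau>] by auto
  let ?P = "\<lambda>n J. clopen_convex X r J \<and> x \<in> J \<and> (n = 0 \<longrightarrow> J = X)"
  have "\<exists>J. \<forall>n. ?P n (J n) \<and> (J (Suc n) \<subset> J n \<and> J (Suc n) \<subseteq> V n)"
  proof (rule dependent_nat_choice)
    show "\<exists>J. ?P 0 J" using clopen_convex_whole x by blast
  next
    fix J and n :: nat assume J: "?P n J"
    hence oJ: "openin \<tau> J" unfolding clopen_convex_def by simp
    have xJ: "x \<in> J" using J by simp
    \<comment> \<open>Perfectness supplies a point to throw out, which forces the next neighbourhood
      to be strictly smaller.\<close>
    obtain z where z: "z \<in> J" "z \<noteq> x" by (rule perfect_other_point[OF perf oJ xJ])
    have "z \<in> X" using openin_subset[OF oJ] z(1) by auto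
    hence "closedin \<tau> {z}" by (rule closedin_singleton)
    hence "openin \<tau> (J \<inter> V n - {z})" using oJ V(1) by (intro openin_diff openin_Int)
    moreover have "x \<in> J \<inter> V n - {z}" using J V(2) z by blast
    ultimately obtain K where "clopen_convex X r K" "x \<in> K" "K \<subseteq> J \<inter> V n - {z}"
      using zd unfolding zero_dimensional_lots_def by meson
    thus "\<exists>K. ?P (Suc n) K \<and> (K \<subset> J \<and> K \<subseteq> V n)" using z(1) by (intro exI[of _ K]) auto
  qed
  then obtain J where "\<forall>n. ?P n (J n) \<and> (J (Suc n) \<subset> J n \<and> J (Suc n) \<subseteq> V n)" by (elim exE)
  hence J: "\<And>n. ?P n (J n)" "\<And>n. J (Suc n) \<subset> J n" "\<And>n. J (Suc n) \<subseteq> V n" by simp_all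
  have "\<exists>n. J n \<subseteq> U" if U: "openin \<tau> U" "x \<in> U" for U
  proof -
    obtain W where W: "W \<in> B" "x \<in> W" "W \<subseteq> U" using B(3) U by blast
    obtain n where "from_nat_into B n = W" using from_nat_into_surj[OF B(1) W(1)] by blast
    hence "V n = W" using W(2) by (simp add: V_def)
    thus ?thesis using J(3)[of n] W(3) by blast
  qed
  thus ?thesis using J by (intro that[of J]) simp_all
qed

lemma clopen_convex_iso_whole:
  assumes comp: "compact_space \<tau>" and cic: "clopen_interval_condition X r"
    and J: "clopen_convex X r J" "J \<noteq> {}"
  shows "order_isomorphic (\<lambda>x y. (x, y) \<in> r) J (\<lambda>x y. (x, y) \<in> r) X"
proof -
  have JX: "J \<subseteq> X" using clopen_convex_subset[OF J(1)] .
  hence "X \<noteq> {}" using J(2) by auto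
  have "order_bounded X r J" "order_bounded X r X"
    using order_bounded_if_compact[OF comp] JX J(2) \<open>X \<noteq> {}\<close> by auto
  thus ?thesis
    using cic J clopen_convex_whole \<open>X \<noteq> {}\<close> unfolding clopen_interval_condition_def by blast
qed

text \<open>For x < y take a clopen convex J around x below y and cut just after its maximum m: the
  points up to m form an open set because J is open. The two halves serve as a template for sets
  with two convex pieces.\<close>

lemma clopen_convex_split:
  assumes comp: "compact_space \<tau>" and zd: "zero_dimensional_lots X r"
    and perf: "perfect_lots X r" and "X \<noteq> {}"
  obtains L R where "clopen_convex X r L" "clopen_convex X r R" "L \<noteq> {}" "R \<noteq> {}" "L \<union> R = X"
    "\<And>x y. x \<in> L \<Longrightarrow> y \<in> R \<Longrightarrow> (x, y) \<in> r"
proof -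
  obtain x' where "x' \<in> X" using \<open>X \<noteq> {}\<close> by blast
  moreover from this obtain y' where "y' \<in> X" "y' \<noteq> x'"
    using perfect_other_point[OF perf, of X] openin_topspace[of \<tau>] by auto
  ultimately obtain x y where xy: "(x, y) \<in> r" using less_total by blast
  hence xyX: "x \<in> X" "y \<in> X" using less_in by auto
  then obtain J where J: "clopen_convex X r J" "x \<in> J" "J \<subseteq> {z \<in> X. (z, y) \<in> r}"
    using zd openin_below[OF xyX(2)] xy unfolding zero_dimensional_lots_def
    by (metis (mono_tags, lifting) mem_Collect_eq)
  have "closedin \<tau> J" using J(1) unfolding clopen_convex_def by simp
  then obtain m where m: "m \<in> J" "\<And>s. s \<in> J \<Longrightarrow> s = m \<or> (s, m) \<in> r"
    using closed_has_max[OF comp, of J] J(2) by auto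
  have mX: "m \<in> X" and my: "(m, y) \<in> r" using m J by auto
  let ?R = "{z \<in> X. (m, z) \<in> r}" and ?L = "{z \<in> X. (z, m) \<in> r} \<union> J"
  have L: "?L = X - ?R"
    using m J(3) mX less_total[of _ m] less_asym less_irrefl by blast
  have R: "?R = X - ?L" using L by blast
  have oL: "openin \<tau> ?L"
    using openin_below[OF mX] J(1) unfolding clopen_convex_def by (simp add: openin_Un)
  have oR: "openin \<tau> ?R" using openin_above[OF mX] .
  have Lm: "z = m \<or> (z, m) \<in> r" if "z \<in> ?L" for z using that m by blast
  have "order_convex X r ?L" "order_convex X r ?R"
    unfolding order_convex_def L using less_trans less_in by blast+
  moreover have "closedin \<tau> ?L"
    using closedin_diff[OF closedin_topspace oR] by (subst L) simp
  moreover have "closedin \<tau> ?R"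
    using closedin_diff[OF closedin_topspace oL] by (subst R) simp
  ultimately have "clopen_convex X r ?L" "clopen_convex X r ?R"
    using oL oR unfolding clopen_convex_def by auto
  moreover have "?L \<noteq> {}" "?R \<noteq> {}" using J(2) my xyX by auto
  moreover have "?L \<union> ?R = X" using L by blast
  moreover have "(u, v) \<in> r" if "u \<in> ?L" "v \<in> ?R" for u v
    using Lm[OF that(1)] that(2) less_trans by blast
  ultimately show ?thesis by (rule that)
qed

text \<open>A point of K splits J - K into a left and a right piece, both clopen and convex. If one
  is empty, J - K is itself a clopen interval; otherwise the pieces are matched with the two halves
  of a clopen splitting of X.\<close>

lemma clopen_convex_diff_iso_whole:
  assumes comp: "compact_space \<tau>" and zd: "zero_dimensional_lots X r"
    and perf: "perfect_lots X r" and cic: "clopen_interval_condition X r"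
    and J: "clopen_convex X r J" and K: "clopen_convex X r K" "K \<subset> J" "K \<noteq> {}"
  shows "order_isomorphic (\<lambda>x y. (x, y) \<in> r) (J - K) (\<lambda>x y. (x, y) \<in> r) X"
proof -
  obtain x where x: "x \<in> K" using K(3) by blast
  have JX: "J \<subseteq> X" using clopen_convex_subset[OF J] .
  have xX: "x \<in> X" using x K(2) JX by blast
  let ?A = "{z \<in> X. (z, x) \<in> r}" and ?B = "{z \<in> X. (x, z) \<in> r}"
  let ?L = "(J - K) \<inter> ?A" and ?R = "(J - K) \<inter> ?B"
  have oC: "openin \<tau> (J - K)" and cC: "closedin \<tau> (J - K)"
    using J K(1) unfolding clopen_convex_def by (auto intro: openin_diff closedin_diff)
  have Le: "?L = (J - K) - ?B" and Re: "?R = (J - K) - ?A"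
    using JX x xX less_total[of x] less_asym less_irrefl by blast+
  have "closedin \<tau> ?L" "closedin \<tau> ?R"
    unfolding Le Re using cC openin_above[OF xX] openin_below[OF xX] by (auto intro: closedin_diff)
  moreover have "openin \<tau> ?L" "openin \<tau> ?R"
    using oC openin_above[OF xX] openin_below[OF xX] by (auto intro: openin_Int)
  moreover have "order_convex X r ?L" "order_convex X r ?R"
    using J K(1) x less_trans unfolding clopen_convex_def order_convex_def
    by (safe; blast)+
  ultimately have cc: "clopen_convex X r ?L" "clopen_convex X r ?R"
    unfolding clopen_convex_def by auto
  have split: "J - K = ?L \<union> ?R" using JX x xX less_total[of _ x] by blast
  have lt: "(u, v) \<in> r" if "u \<in> ?L" "v \<in> ?R" for u v using that less_trans by blast
  note iso = clopen_convex_iso_whole[OF comp cic]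
  show ?thesis
  proof (cases "?L = {} \<or> ?R = {}")
    case True
    hence "J - K = ?L \<or> J - K = ?R" using split by blast
    hence "clopen_convex X r (J - K)"
    proof
      assume e: "J - K = ?L"
      show ?thesis by (subst e) (rule cc(1))
    next
      assume e: "J - K = ?R"
      show ?thesis by (subst e) (rule cc(2))
    qed
    thus ?thesis using K(2) by (intro iso) auto
  next
    case False
    have "X \<noteq> {}" using xX by blast
    then obtain L' R' where LR: "clopen_convex X r L'" "clopen_convex X r R'" "L' \<noteq> {}" "R' \<noteq> {}"
        "L' \<union> R' = X" "\<And>x y. x \<in> L' \<Longrightarrow> y \<in> R' \<Longrightarrow> (x, y) \<in> r"
      using clopen_convex_split[OF comp zd perf] by metis
    have "order_isomorphic (\<lambda>x y. (x, y) \<in> r) ?L (\<lambda>x y. (x, y) \<in> r) L'"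
      by (rule order_isomorphic_trans[OF iso order_isomorphic_sym[OF iso]]) (use cc False LR in auto)
    moreover have "order_isomorphic (\<lambda>x y. (x, y) \<in> r) ?R (\<lambda>x y. (x, y) \<in> r) R'"
      by (rule order_isomorphic_trans[OF iso order_isomorphic_sym[OF iso]]) (use cc False LR in auto)
    ultimately have "order_isomorphic (\<lambda>x y. (x, y) \<in> r) (?L \<union> ?R) (\<lambda>x y. (x, y) \<in> r) (L' \<union> R')"
      by (rule order_isomorphic_Un) (use lt LR(6) less_asym in blast)+
    thus ?thesis using split LR(5) by metis
  qed
qed

text \<open>The complement of a point is the disjoint union of the differences of consecutive members of a
  shrinking sequence of clopen convex neighbourhoods.  These differences are all order isomorphic,
  so that any two points can be exchanged piece by piece.\<close>

theorem homogeneous_if_first_countable: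
  assumes comp: "compact_space \<tau>" and zd: "zero_dimensional_lots X r"
    and perf: "perfect_lots X r" and cic: "clopen_interval_condition X r"
    and fc: "first_countable \<tau>"
  shows "topologically_homogeneous \<tau>"
  unfolding topologically_homogeneous_def
proof (intro ballI)
  fix x y assume "x \<in> topspace \<tau>" "y \<in> topspace \<tau>"
  hence x: "x \<in> X" and y: "y \<in> X" by simp_all
  have ring: "disjoint_family (\<lambda>n. J n - J (Suc n))"
      "(\<Union>n. J n - J (Suc n)) = X - {z}"
    if J0: "J 0 = X" and zJ: "\<And>n. z \<in> J n" and dec: "\<And>n. J (Suc n) \<subset> J n"
      and base: "\<And>U. openin \<tau> U \<Longrightarrow> z \<in> U \<Longrightarrow> \<exists>n. J n \<subseteq> U" and z: "z \<in> X" for z J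
  proof -
    have mono: "J n \<subseteq> J m" if "m \<le> n" for m n
      by (rule lift_Suc_antimono_le[of J, OF _ that]) (use dec in blast)
    have "(J m - J (Suc m)) \<inter> (J n - J (Suc n)) = {}" if "m < n" for m n
      using mono[of "Suc m" n] that by auto
    thus "disjoint_family (\<lambda>n. J n - J (Suc n))"
      unfolding disjoint_family_on_def by (metis Int_commute linorder_neqE_nat)
    have "w \<in> (\<Union>n. J n - J (Suc n))" if w: "w \<in> X" "w \<noteq> z" for w
    proof -
      have "openin \<tau> (X - {w})" using closedin_singleton[OF w(1)] by (simp add: closedin_def)
      then obtain N where N: "J N \<subseteq> X - {w}" using base[of "X - {w}"] w z by auto
      \<comment> \<open>The first neighbourhood missing w is not \<open>J 0\<close>, which is all of
        X, so w lies in its predecessor and hence in a difference.\<close>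
      define n where "n = (LEAST n. w \<notin> J n)"
      have n: "w \<notin> J n" unfolding n_def by (rule LeastI[of _ N]) (use N in blast)
      then obtain k where k: "n = Suc k" using J0 w(1) by (cases n) auto
      hence "w \<in> J k" using not_less_Least[of k "\<lambda>n. w \<notin> J n"] unfolding n_def by simp
      thus ?thesis using n k by blast
    qed
    moreover have "J n \<subseteq> X" for n using mono[of 0 n] J0 by simp
    ultimately show "(\<Union>n. J n - J (Suc n)) = X - {z}" using zJ by blast
  qed
  obtain J where J: "J 0 = X" "\<And>n. clopen_convex X r (J n)" "\<And>n. x \<in> J n" "\<And>n. J (Suc n) \<subset> J n"
      "\<And>U. openin \<tau> U \<Longrightarrow> x \<in> U \<Longrightarrow> \<exists>n. J n \<subseteq> U"
    using shrinking_clopen_neighbourhoods[OF zd perf fc x] by metis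
  obtain K where K: "K 0 = X" "\<And>n. clopen_convex X r (K n)" "\<And>n. y \<in> K n" "\<And>n. K (Suc n) \<subset> K n"
      "\<And>U. openin \<tau> U \<Longrightarrow> y \<in> U \<Longrightarrow> \<exists>n. K n \<subseteq> U"
    using shrinking_clopen_neighbourhoods[OF zd perf fc y] by metis
  define C where "C n = J n - J (Suc n)" for n
  define D where "D n = K n - K (Suc n)" for n
  note ringC = ring[OF J(1,3,4,5) x, folded C_def]
  note ringD = ring[OF K(1,3,4,5) y, folded D_def]
  have clopen: "openin \<tau> (C n)" "closedin \<tau> (C n)" "closedin \<tau> (D n)" for n
    using J(2) K(2) unfolding C_def D_def clopen_convex_def
    by (auto intro: openin_diff closedin_diff)
  have "order_isomorphic (\<lambda>x y. (x, y) \<in> r) (C n) (\<lambda>x y. (x, y) \<in> r) (D n)" for n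
  proof -
    note iso = clopen_convex_diff_iso_whole[OF comp zd perf cic]
    have "order_isomorphic (\<lambda>x y. (x, y) \<in> r) (C n) (\<lambda>x y. (x, y) \<in> r) X"
      unfolding C_def using J(3) by (intro iso J(2) J(4)) blast
    moreover have "order_isomorphic (\<lambda>x y. (x, y) \<in> r) (D n) (\<lambda>x y. (x, y) \<in> r) X"
      unfolding D_def using K(3) by (intro iso K(2) K(4)) blast
    ultimately show ?thesis by (rule order_isomorphic_trans[OF _ order_isomorphic_sym])
  qed
  then obtain g where g: "\<And>n. bij_betw (g n) (C n) (D n)"
      "\<And>n u v. u \<in> C n \<Longrightarrow> v \<in> C n \<Longrightarrow> (u, v) \<in> r \<longleftrightarrow> (g n u, g n v) \<in> r"
    unfolding order_isomorphic_def by metis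
  define f where "f z = (if z = x then y else g (THE n. z \<in> C n) z)" for z
  have xC: "x \<notin> C n" for n using J(3) by (auto simp: C_def)
  have f: "f z = g n z" if "z \<in> C n" for z n
  proof -
    have "(THE n. z \<in> C n) = n"
      using that ringC(1) unfolding disjoint_family_on_def by (intro the_equality) auto
    thus ?thesis using that xC by (auto simp: f_def)
  qed
  have fx: "f x = y" by (simp add: f_def)
  have "bij_betw f (\<Union>n. C n) (\<Union>n. D n)"
  proof (rule bij_betw_UNION_disjoint)
    show "bij_betw f (C n) (D n)" for n using g(1)[of n] f by (simp cong: bij_betw_cong)
  qed (rule ringD(1))
  hence "bij_betw f (X - {x}) (X - {y})" using ringC(2) ringD(2) by simp
  hence bij: "bij_betw f X X"
    using notIn_Un_bij_betw[of x "X - {x}" f "X - {y}"] x y fx by (simp add: insert_absorb)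
  have "continuous_map \<tau> \<tau> f"
    unfolding continuous_map_def
  proof (intro conjI allI impI)
    show "f \<in> topspace \<tau> \<rightarrow> topspace \<tau>" using bij by (auto simp: bij_betw_def)
    fix V assume V: "openin \<tau> V"
    have piece: "openin \<tau> {z \<in> C n. g n z \<in> V}" for n
    proof -
      have "continuous_map (subtopology \<tau> (C n)) \<tau> (g n)"
        using continuous_map_order_iso[OF comp clopen(2,3) g] .
      hence "openin (subtopology \<tau> (C n)) {z \<in> topspace (subtopology \<tau> (C n)). g n z \<in> V}"
        using V by (rule openin_continuous_map_preimage)
      moreover have "topspace (subtopology \<tau> (C n)) = C n"
        using openin_subset[OF clopen(1)] by (rule topspace_subtopology_subset)
      ultimately have "openin (subtopology \<tau> (C n)) {z \<in> C n. g n z \<in> V}" by (simp only:)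
      thus ?thesis using clopen(1) by (rule openin_trans_full)
    qed
    \<comment> \<open>Continuity at x, the only point outside all pieces: if \<open>K N\<close> is
      contained in V then f maps \<open>J N\<close> into \<open>K N\<close>, because the n-th piece
      goes to the n-th piece and the pieces met by \<open>J N\<close> have n \<ge> N.\<close>
    have "\<exists>W. openin \<tau> W \<and> W \<subseteq> {z \<in> X. f z \<in> V} \<and> (y \<in> V \<longrightarrow> x \<in> W)"
    proof (cases "y \<in> V")
      case True
      then obtain N where N: "K N \<subseteq> V" using K(5) V by blast
      have "f z \<in> V" if z: "z \<in> J N" for z
      proof (cases "z = x")
        case False
        have "z \<in> X" using z clopen_convex_subset[OF J(2)] by blast
        then obtain n where n: "z \<in> C n" using ringC(2) False by blast
        have "J N \<subseteq> J (Suc n)" if "Suc n \<le> N"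
          by (rule lift_Suc_antimono_le[of J, OF _ that]) (use J(4) in blast)
        hence "N \<le> n" using n z unfolding C_def by (cases "Suc n \<le> N") auto
        hence "K n \<subseteq> K N" by (rule lift_Suc_antimono_le[of K, rotated]) (use K(4) in blast)
        moreover have "f z \<in> D n" using f[OF n] bij_betw_apply[OF g(1) n] by simp
        ultimately show ?thesis using N by (auto simp: D_def)
      qed (use True fx in simp)
      thus ?thesis
        using J(2)[of N] J(3) clopen_convex_subset[OF J(2)] unfolding clopen_convex_def by blast
    qed (auto intro: exI[of _ "{}"])
    then obtain W where W: "openin \<tau> W" "W \<subseteq> {z \<in> X. f z \<in> V}" "y \<in> V \<Longrightarrow> x \<in> W" by blast
    have "{z \<in> topspace \<tau>. f z \<in> V} = W \<union> (\<Union>n. {z \<in> C n. g n z \<in> V})"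
    proof (intro equalityI subsetI)
      fix z assume z: "z \<in> {z \<in> topspace \<tau>. f z \<in> V}"
      show "z \<in> W \<union> (\<Union>n. {z \<in> C n. g n z \<in> V})"
      proof (cases "z = x")
        case False
        then obtain n where "z \<in> C n" using ringC(2) z by auto
        thus ?thesis using f z by auto
      qed (use W(3) fx z in auto)
    next
      fix z assume "z \<in> W \<union> (\<Union>n. {z \<in> C n. g n z \<in> V})"
      thus "z \<in> {z \<in> topspace \<tau>. f z \<in> V}" using W(2) f ringC(2) by auto
    qed
    moreover have "openin \<tau> (\<Union>n. {z \<in> C n. g n z \<in> V})" using piece by (intro openin_Union) auto
    ultimately show "openin \<tau> {z \<in> topspace \<tau>. f z \<in> V}" using W(1) by (simp only: openin_Un)
  qed
  \<comment> \<open>A continuous bijection from a compact space to a Hausdorff space has a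
    continuous inverse.\<close>
  hence "homeomorphic_map \<tau> \<tau> f"
    using comp Hausdorff_if_zero_dimensional[OF zd] bij
    by (intro continuous_imp_homeomorphic_map) (auto simp: bij_betw_def)
  thus "\<exists>f. homeomorphic_map \<tau> \<tau> f \<and> f x = y" using fx by blast
qed

end

section \<open>Order types of subsets of a well-order\<close>

text \<open>The collapse of a well-ordered set: g sends k to the order type of the part of Z below
  k, defined by recursion as the least strict upper bound of the earlier values. A type without
  suprema still contains this bound, because g k \<le> k holds by induction.\<close>

lemma order_type_exists:
  fixes Z :: "'o::wellorder set"
  shows "\<exists>g. \<forall>k. g k \<le> k \<and> (\<forall>j\<in>Z. j < k \<longrightarrow> g j < g k) \<and> g ` (Z \<inter> {..<k}) = {..<g k}"
proof -
  define F where "F f k = (LEAST y. \<forall>j\<in>Z \<inter> {..<k}. f j < y)" for f :: "'o \<Rightarrow> 'o" and k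
  define g where "g = wfrec {(x, y). x < y} F"
  have wf: "wf {(x, y). x < (y::'o)}" by (rule wf)
  have g: "g k = (LEAST y. \<forall>j\<in>Z \<inter> {..<k}. g j < y)" for k
  proof -
    have "g k = F (cut g {(x, y). x < y} k) k"
      unfolding g_def by (rule wfrec[OF wf])
    also have "\<dots> = F g k"
      unfolding F_def by (rule arg_cong[where f = Least]) (auto simp: cut_def fun_eq_iff)
    finally show ?thesis by (simp add: F_def)
  qed
  have le: "g k \<le> k" for k
  proof (induction k rule: less_induct)
    case (less k)
    show ?case by (subst g, rule Least_le) (use less in fastforce)
  qed
  have mono: "g j < g k" if "j \<in> Z" "j < k" for j k
  proof -
    have "\<forall>j\<in>Z \<inter> {..<k}. g j < k" using le by (meson IntD2 lessThan_iff le_less_trans)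
    hence "\<forall>j\<in>Z \<inter> {..<k}. g j < g k" by (subst g, rule LeastI)
    thus ?thesis using that by auto
  qed
  have surj: "y \<in> g ` (Z \<inter> {..<k})" if "y < g k" for y k
    using that
  proof (induction k rule: less_induct)
    case (less k)
    have "\<not> (\<forall>j\<in>Z \<inter> {..<k}. g j < y)"
      by (rule not_less_Least) (use less.prems g[of k] in simp)
    then obtain j where j: "j \<in> Z" "j < k" "y \<le> g j" by (auto simp: not_less)
    show ?case
    proof (cases "y = g j")
      case False
      with j have "y \<in> g ` (Z \<inter> {..<j})" using less.IH[of j] by auto
      thus ?thesis using j by auto
    qed (use j in auto)
  qed
  show ?thesis
    by (rule exI[of _ g]) (use le mono surj in auto)
qed

definition order_type :: "'o::wellorder set \<Rightarrow> 'o \<Rightarrow> 'o" where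
  "order_type Z = (SOME g. \<forall>k. g k \<le> k \<and> (\<forall>j\<in>Z. j < k \<longrightarrow> g j < g k) \<and> g ` (Z \<inter> {..<k}) = {..<g k})"

lemma order_type_le: "order_type Z k \<le> k"
  and order_type_less: "j \<in> Z \<Longrightarrow> j < k \<Longrightarrow> order_type Z j < order_type Z k"
  and order_type_image: "order_type Z ` (Z \<inter> {..<k}) = {..<order_type Z k}"
  using someI_ex[OF order_type_exists[of Z]] unfolding order_type_def by blast+

text \<open>For \<open>i \<le> k\<close> the order type of \<open>{i..<k}\<close> is \<open>k - i\<close>, the ordinal \<open>d\<close> with \<open>i + d = k\<close>.\<close>

definition ord_diff :: "'o::wellorder \<Rightarrow> 'o \<Rightarrow> 'o" where
  "ord_diff i = order_type {i..}"

lemma ord_diff_le: "ord_diff i k \<le> k"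
  unfolding ord_diff_def by (rule order_type_le)

lemma ord_diff_image: "ord_diff i ` {i..<k} = {..<ord_diff i k}"
  using order_type_image[of "{i..}" k] unfolding ord_diff_def
  by (simp add: atLeastLessThan_def)

lemma ord_diff_less_iff: "i \<le> j \<Longrightarrow> i \<le> k \<Longrightarrow> ord_diff i j < ord_diff i k \<longleftrightarrow> j < k"
  using order_type_less[of j "{i..}" k] order_type_less[of k "{i..}" j]
  unfolding ord_diff_def by (cases j k rule: linorder_cases) auto

lemma ord_diff_eq_iff: "i \<le> j \<Longrightarrow> i \<le> k \<Longrightarrow> ord_diff i j = ord_diff i k \<longleftrightarrow> j = k"
  using ord_diff_less_iff by (metis less_irrefl linorder_neqE)

lemma ord_diff_surj: "d < ord_diff i k \<Longrightarrow> \<exists>m. i \<le> m \<and> m < k \<and> ord_diff i m = d"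
  using ord_diff_image[of i k] by (metis atLeastLessThan_iff imageE lessThan_iff)

lemma ord_zero_le: "ord_zero \<le> i"
  unfolding ord_zero_def by (simp add: Least_le)

lemma ord_diff_self: "ord_diff i i = ord_zero"
proof -
  have "\<not> ord_zero < ord_diff i i" using ord_diff_image[of i i] by auto
  thus ?thesis using ord_zero_le[of "ord_diff i i"] by auto
qed

section \<open>Rigidity of ordinals and the passage from sums to differences\<close>

lemma le_order_embedding:
  fixes f :: "'o::wellorder \<Rightarrow> 'o"
  assumes f: "\<And>x y. x < y \<Longrightarrow> y < a \<Longrightarrow> f x < f y" and "x < a"
  shows "x \<le> f x"
  using \<open>x < a\<close>
proof (induction x rule: less_induct)
  case (less x)
  show ?case
  proof (rule ccontr)
    assume "\<not> x \<le> f x"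
    hence "f x < x" by simp
    hence "f x \<le> f (f x)" using less by auto
    thus False using f[OF \<open>f x < x\<close>] less.prems by auto
  qed
qed

lemma order_isomorphic_lessThan_le:
  fixes a b :: "'o::wellorder"
  assumes "order_isomorphic (<) {..<a} (<) {..<b}"
  shows "a \<le> b"
proof (rule ccontr)
  assume "\<not> a \<le> b"
  hence ba: "b < a" by simp
  obtain f where f: "bij_betw f {..<a} {..<b}" "\<And>x y. x < a \<Longrightarrow> y < a \<Longrightarrow> x < y \<longleftrightarrow> f x < f y"
    using assms unfolding order_isomorphic_def by auto
  have "f x < f y" if "x < y" "y < a" for x y
    using that f(2)[of x y] by simp
  hence "b \<le> f b" using ba by (rule le_order_embedding)
  moreover have "f b < b" using bij_betw_apply[OF f(1)] ba by auto
  ultimately show False by simp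
qed

lemma order_isomorphic_ord_diff:
  "order_isomorphic (<) {i..<m} (<) {..<ord_diff i m}"
proof -
  have "inj_on (ord_diff i) {i..<m}" by (intro inj_onI) (simp add: ord_diff_eq_iff)
  hence "bij_betw (ord_diff i) {i..<m} {..<ord_diff i m}"
    using ord_diff_image unfolding bij_betw_def by blast
  thus ?thesis
    unfolding order_isomorphic_def
    by (intro exI[of _ "ord_diff i"]) (simp add: ord_diff_less_iff)
qed

text \<open>Replaces the partial relation i + d = m by the total operation m - i. Uniqueness of d is
  rigidity: isomorphic initial segments of a well-order are equal.\<close>

lemma ord_sum_iff: "ord_sum i d m \<longleftrightarrow> i \<le> m \<and> ord_diff i m = d"
proof
  assume "ord_sum i d m"
  hence "i \<le> m" and "order_isomorphic (<) {..<d} (<) {i..<m}" unfolding ord_sum_def by auto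
  from this(2) have "order_isomorphic (<) {..<d} (<) {..<ord_diff i m}"
    using order_isomorphic_ord_diff by (rule order_isomorphic_trans)
  hence "ord_diff i m = d"
    using order_isomorphic_lessThan_le order_isomorphic_sym by (metis order.antisym)
  thus "i \<le> m \<and> ord_diff i m = d" using \<open>i \<le> m\<close> by blast
next
  assume "i \<le> m \<and> ord_diff i m = d"
  thus "ord_sum i d m"
    unfolding ord_sum_def using order_isomorphic_sym[OF order_isomorphic_ord_diff] by blast
qed

lemma down_closed_eq_lessThan:
  fixes A :: "'o::wellorder set"
  assumes "\<And>i j. i < j \<Longrightarrow> j \<in> A \<Longrightarrow> i \<in> A" "b \<notin> A"
  shows "\<exists>h. A = {..<h}"
proof (intro exI equalityI subsetI)
  let ?h = "LEAST h. h \<notin> A"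
  have h: "?h \<notin> A" using assms(2) by (rule LeastI)
  fix k
  show "k \<in> A" if "k \<in> {..<?h}" using that not_less_Least by auto
  show "k \<in> {..<?h}" if "k \<in> A"
    using assms(1)[of ?h k] that h by (cases k ?h rule: linorder_cases) auto
qed


section \<open>Concatenation and tails\<close>

text \<open>The sum p + x read off from the result: place k beyond p takes the digit of x at k -
  \<open>len p\<close>. In this form no sum of ordinals has to exist.\<close>

definition cat :: "('o::wellorder \<rightharpoonup> bool) \<Rightarrow> ('o \<rightharpoonup> bool) \<Rightarrow> ('o \<rightharpoonup> bool)" where
  "cat p x = (\<lambda>k. if k < len p then p k else x (ord_diff (len p) k))"

text \<open>The part of y from place i on, moved to start at zero. The guard gives
  \<open>None\<close> at every d for which i + d does not exist in the type.\<close>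

definition tail :: "'o::wellorder \<Rightarrow> ('o \<rightharpoonup> bool) \<Rightarrow> ('o \<rightharpoonup> bool)" where
  "tail i y = (\<lambda>d. if d \<in> ord_diff i ` {i..} then y (THE m. i \<le> m \<and> ord_diff i m = d) else None)"

lemma tail_ord_diff: "i \<le> m \<Longrightarrow> tail i y (ord_diff i m) = y m"
proof -
  assume m: "i \<le> m"
  hence "(THE m'. i \<le> m' \<and> ord_diff i m' = ord_diff i m) = m"
    by (intro the_equality) (auto simp: ord_diff_eq_iff)
  thus ?thesis using m unfolding tail_def by auto
qed

lemma tail_outside: "d \<notin> ord_diff i ` {i..} \<Longrightarrow> tail i y d = None"
  unfolding tail_def by simp

lemma dom_tail:
  assumes "dom y = {..<l}"
  shows "dom (tail i y) = {..<ord_diff i l}"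
proof -
  have "d \<in> dom (tail i y) \<longleftrightarrow> d \<in> ord_diff i ` {i..<l}" for d
  proof (cases "d \<in> ord_diff i ` {i..}")
    case True
    then obtain m where m: "i \<le> m" "d = ord_diff i m" by auto
    have "d \<in> dom (tail i y) \<longleftrightarrow> m \<in> dom y" unfolding domIff m(2) tail_ord_diff[OF m(1)] ..
    also have "\<dots> \<longleftrightarrow> m \<in> {i..<l}" using m assms by simp
    also have "\<dots> \<longleftrightarrow> d \<in> ord_diff i ` {i..<l}" using m by (auto simp: ord_diff_eq_iff)
    finally show ?thesis .
  next
    case False
    thus ?thesis using tail_outside[OF False] by (auto simp: domIff)
  qed
  hence "dom (tail i y) = ord_diff i ` {i..<l}" by (rule set_eqI)
  thus ?thesis unfolding ord_diff_image .
qed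

lemma cat_tail:
  assumes "p \<subseteq>\<^sub>m y" "dom p = {..<len p}"
  shows "cat p (tail (len p) y) = y"
proof
  fix k
  show "cat p (tail (len p) y) k = y k"
    using assms tail_ord_diff[of "len p" k y] by (auto simp: cat_def map_le_def)
qed

lemma le_map_cat: "dom p = {..<len p} \<Longrightarrow> p \<subseteq>\<^sub>m cat p x"
  unfolding map_le_def cat_def by auto

lemma map_le_of_common_upper: "p \<subseteq>\<^sub>m x \<Longrightarrow> q \<subseteq>\<^sub>m x \<Longrightarrow> dom p \<subseteq> dom q \<Longrightarrow> p \<subseteq>\<^sub>m q"
  unfolding map_le_def by (simp add: subset_iff)

definition bits :: "('o::wellorder \<Rightarrow> bool) \<Rightarrow> 'o \<Rightarrow> ('o \<rightharpoonup> bool)" where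
  "bits f h = (\<lambda>k. if k < h then Some (f k) else None)"

lemma dom_bits: "dom (bits f h) = {..<h}"
  unfolding bits_def by (auto split: if_splits)

lemma len_bits: "len (bits f h) = h"
  using dom_bits by (rule len_eqI)

lemma bits_restrict: "i \<le> h \<Longrightarrow> bits f h |` {..<i} = bits f i"
  unfolding bits_def restrict_map_def by (auto simp: fun_eq_iff)

text \<open>For \<open>c = False\<close> this is the converse of the order from left to right; having both allows one to
  treat left and right ends of intervals alike.\<close>

definition lex_less :: "bool \<Rightarrow> ('o::wellorder \<rightharpoonup> bool) \<Rightarrow> ('o \<rightharpoonup> bool) \<Rightarrow> bool" where
  "lex_less c x y \<longleftrightarrow> (\<exists>\<epsilon>. (\<forall>i<\<epsilon>. x i = y i) \<and> x \<epsilon> = Some (\<not> c) \<and> y \<epsilon> = Some c)"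

lemma lex_lessI: "(\<And>i. i < \<epsilon> \<Longrightarrow> x i = y i) \<Longrightarrow> x \<epsilon> = Some (\<not> c) \<Longrightarrow> y \<epsilon> = Some c \<Longrightarrow> lex_less c x y"
  unfolding lex_less_def by blast

lemma lex_less_flip: "lex_less False x y \<longleftrightarrow> lex_less True y x"
  unfolding lex_less_def by (metis (full_types))

lemma lex_less_irrefl: "\<not> lex_less c x x"
  unfolding lex_less_def by auto

lemma lex_less_trans: "lex_less c x y \<Longrightarrow> lex_less c y z \<Longrightarrow> lex_less c x z"
proof -
  assume "lex_less c x y" "lex_less c y z"
  then obtain \<delta> \<epsilon> where d: "\<forall>i<\<delta>. x i = y i" "x \<delta> = Some (\<not> c)" "y \<delta> = Some c"
    and e: "\<forall>i<\<epsilon>. y i = z i" "y \<epsilon> = Some (\<not> c)" "z \<epsilon> = Some c"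
    unfolding lex_less_def by blast
  consider "\<delta> < \<epsilon>" | "\<epsilon> < \<delta>" using d(3) e(2) by (cases \<delta> \<epsilon> rule: linorder_cases) auto
  thus "lex_less c x z"
  proof cases
    case 1
    show ?thesis by (rule lex_lessI[of \<delta>]) (use d e 1 in auto)
  next
    case 2
    show ?thesis by (rule lex_lessI[of \<epsilon>]) (use d e 2 in auto)
  qed
qed

lemma lex_less_asym: "lex_less c x y \<Longrightarrow> \<not> lex_less c y x"
  using lex_less_trans lex_less_irrefl by blast

section \<open>Vertices of the tree: restriction, concatenation and tails\<close>

locale tail_like_tree =
  fixes T :: "('o::wellorder \<rightharpoonup> bool) set" and \<alpha> :: 'o
  assumes tree: "additive_tree T \<alpha>" and tail_like: "tail_like \<alpha>"
    and len_const_branch: "\<And>b. len (const_branch T b) = \<alpha>"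
begin

abbreviation X :: "('o \<rightharpoonup> bool) set" where "X \<equiv> branch_space T"

lemma tree_simple: "p \<in> T \<Longrightarrow> p \<in> simple_tree \<alpha>"
  using tree unfolding additive_tree_def by blast

lemma tree_dom: "p \<in> T \<Longrightarrow> dom p = {..<len p}"
  using tree_simple simple_tree_dom by blast

lemma tree_len: "p \<in> T \<Longrightarrow> len p < \<alpha>"
  using tree_simple simple_tree_len by blast

lemma empty_in_tree: "Map.empty \<in> T"
  using tree unfolding additive_tree_def by blast

lemma len_empty: "len (Map.empty :: 'o \<rightharpoonup> bool) = ord_zero"
  by (rule len_eqI) (use ord_zero_le in \<open>auto simp: not_less[symmetric]\<close>)

lemma ord_diff_height: "i < \<alpha> \<Longrightarrow> ord_diff i \<alpha> = \<alpha>"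
  using tail_like unfolding tail_like_def ord_sum_iff by blast

text \<open>Tail-likeness makes addition total below \<alpha>: as \<alpha> - i = \<alpha>, the
  differences m - i with m < \<alpha> run through all ordinals below \<alpha>.\<close>

lemma ord_add_exists: "i < \<alpha> \<Longrightarrow> d < \<alpha> \<Longrightarrow> \<exists>m. i \<le> m \<and> m < \<alpha> \<and> ord_diff i m = d"
  using ord_diff_surj[of d i \<alpha>] ord_diff_height by simp

lemma tree_restrict:
  assumes "p \<in> T"
  shows "p |` {..<i} \<in> T"
proof (cases "i \<le> len p")
  case False
  hence "p |` {..<i} = p" using tree_dom[OF assms] by (intro map_le_antisym) (auto simp: map_le_def)
  thus ?thesis using assms by simp
qed (rule additive_tree_restrict[OF tree assms])

lemma tree_cat:
  assumes p: "p \<in> T" and q: "q \<in> T"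
  shows "cat p q \<in> T"
proof -
  obtain r where r: "r \<in> T" "is_concat p q r"
    using tree p q tree_simple unfolding additive_tree_def by blast
  have "r k = cat p q k" for k
  proof (cases "k < len p")
    case True
    thus ?thesis using r(2) unfolding is_concat_def cat_def by simp
  next
    case False
    let ?d = "ord_diff (len p) k"
    have l: "len p \<le> len r" "ord_diff (len p) (len r) = len q"
      using r(2) unfolding is_concat_def ord_sum_iff by auto
    have "r k = q ?d"
    proof (cases "?d < len q")
      case True
      thus ?thesis using r(2) False unfolding is_concat_def ord_sum_iff by auto
    next
      case F: False
      hence "\<not> k < len r" using l False ord_diff_less_iff[of "len p" k "len r"] by simp
      hence "k \<notin> dom r" "?d \<notin> dom q" using F tree_dom r(1) q by auto
      thus ?thesis by (simp add: domIff)
    qed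
    thus ?thesis using False by (simp add: cat_def)
  qed
  hence "r = cat p q" by (rule ext)
  thus ?thesis using r(1) by simp
qed

text \<open>The decomposing half of additivity: r is the concatenation of its restriction to i with
  this tail, so both summands are vertices.\<close>

lemma tree_tail:
  assumes r: "r \<in> T" and i: "i \<le> len r"
  shows "tail i r \<in> T"
proof -
  let ?p = "r |` {..<i}" and ?q = "tail i r"
  have dr: "dom r = {..<len r}" by (rule tree_dom[OF r])
  have lp: "len ?p = i" by (rule len_eqI) (use dr i in auto)
  have dq: "dom ?q = {..<ord_diff i (len r)}" using dr by (rule dom_tail)
  have lq: "len ?q = ord_diff i (len r)" by (rule len_eqI[OF dq])
  have "ord_diff i (len r) < \<alpha>" using ord_diff_le tree_len[OF r] by (rule le_less_trans)
  hence "?q \<in> simple_tree \<alpha>" using dq unfolding simple_tree_def by blast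
  moreover have "is_concat ?p ?q r"
    unfolding is_concat_def lp lq ord_sum_iff using dr i by (auto simp: tail_ord_diff[symmetric])
  ultimately show ?thesis
    using tree r tree_simple[OF tree_restrict[OF r]] unfolding additive_tree_def by blast
qed

lemma tree_snoc:
  assumes p: "p \<in> T"
  shows "p(len p \<mapsto> b) \<in> T"
proof -
  have "[ord_zero \<mapsto> b] \<in> T" using tree unfolding additive_tree_def by blast
  hence "cat p [ord_zero \<mapsto> b] \<in> T" using p by (rule tree_cat[rotated])
  moreover have "cat p [ord_zero \<mapsto> b] = p(len p \<mapsto> b)"
  proof
    fix k
    consider "k < len p" | "k = len p" | "len p < k" by fastforce
    thus "cat p [ord_zero \<mapsto> b] k = (p(len p \<mapsto> b)) k"
    proof cases
      case 3
      hence "ord_diff (len p) k \<noteq> ord_diff (len p) (len p)" by (simp add: ord_diff_eq_iff)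
      hence "ord_diff (len p) k \<noteq> ord_zero" unfolding ord_diff_self .
      moreover have "p k = None" using tree_dom[OF p] 3 by (metis domIff lessThan_iff less_asym)
      ultimately show ?thesis using 3 by (auto simp: cat_def)
    qed (auto simp: cat_def ord_diff_self)
  qed
  ultimately show ?thesis by simp
qed

lemma dom_snoc: "p \<in> T \<Longrightarrow> dom (p(len p \<mapsto> b)) = {..len p}"
  using tree_dom[of p] by auto

lemma le_map_iff: "p \<in> T \<Longrightarrow> p \<subseteq>\<^sub>m y \<longleftrightarrow> (\<forall>i<len p. p i = y i)"
  using tree_dom[of p] unfolding map_le_def by (simp add: Ball_def)

lemma snoc_le_iff:
  assumes p: "p \<in> T"
  shows "p(len p \<mapsto> b) \<subseteq>\<^sub>m y \<longleftrightarrow> p \<subseteq>\<^sub>m y \<and> y (len p) = Some b"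
proof -
  have "p(len p \<mapsto> b) \<subseteq>\<^sub>m y \<longleftrightarrow> (\<forall>i\<le>len p. (p(len p \<mapsto> b)) i = y i)"
    unfolding map_le_def dom_snoc[OF p] by (simp only: Ball_def atMost_iff)
  also have "\<dots> \<longleftrightarrow> (\<forall>i<len p. p i = y i) \<and> y (len p) = Some b"
    by (auto simp: order.order_iff_strict)
  finally show ?thesis unfolding le_map_iff[OF p] .
qed


subsection \<open>Branches\<close>

text \<open>With \<open>branch_props\<close> this replaces maximal chains by a property of
  functions: a branch is a word whose proper initial parts are vertices while it is not a vertex
  itself. The witnessing chain consists of all vertices below x.\<close>

lemma branchI:
  assumes dx: "dom x = {..<h}" and res: "\<And>i. i < h \<Longrightarrow> x |` {..<i} \<in> T" and nin: "x \<notin> T"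
  shows "x \<in> X"
proof -
  let ?C = "{p \<in> T. p \<subseteq>\<^sub>m x}"
  have chain_iff: "pred_on.chain T tree_less S \<longleftrightarrow>
      S \<subseteq> T \<and> (\<forall>p\<in>S. \<forall>q\<in>S. p \<subseteq>\<^sub>m q \<or> q \<subseteq>\<^sub>m p)" for S
  proof -
    have "tree_less\<^sup>=\<^sup>= p q \<longleftrightarrow> p \<subseteq>\<^sub>m q" for p q :: "'o \<rightharpoonup> bool"
      unfolding tree_less_def by (auto simp: map_le_refl)
    thus ?thesis unfolding pred_on.chain_def by simp
  qed
  \<comment> \<open>The vertex reaching just past i is x cut at i with one digit appended, so no
    ordinal successor is needed.\<close>
  have ex: "\<exists>p\<in>?C. i \<in> dom p" if d: "i \<in> dom x" for i
  proof -
    let ?p = "x |` {..<i}"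
    have i: "i < h" using d dx by simp
    have l: "len ?p = i" by (rule len_eqI) (use dx i in auto)
    obtain b where b: "x i = Some b" using d by blast
    have "?p(i \<mapsto> b) \<in> T" using tree_snoc[OF res[OF i], of b] l by simp
    hence "?p(i \<mapsto> b) \<in> ?C" using b by (auto simp: map_le_def restrict_map_def)
    thus ?thesis by (rule bexI[rotated]) simp
  qed
  have chain: "pred_on.chain T tree_less ?C"
  proof -
    have "p \<subseteq>\<^sub>m q \<or> q \<subseteq>\<^sub>m p" if "p \<in> ?C" "q \<in> ?C" for p q
    proof -
      have "dom p \<subseteq> dom q \<or> dom q \<subseteq> dom p"
        using tree_dom[of p] tree_dom[of q] that by auto
      thus ?thesis using that map_le_of_common_upper by (elim disjE) blast+
    qed
    thus ?thesis unfolding chain_iff by simp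
  qed
  \<comment> \<open>A vertex r of a larger chain that is not below x is below no member of the old
    chain, so it extends them all and hence x. Then x is a restriction of r and would be a
    vertex.\<close>
  have "S = ?C" if S: "pred_on.chain T tree_less S" "?C \<subseteq> S" for S
  proof (rule ccontr)
    assume "S \<noteq> ?C"
    then obtain r where r: "r \<in> S" "r \<notin> ?C" using S(2) by blast
    have ST: "S \<subseteq> T" and cmp: "\<And>p. p \<in> S \<Longrightarrow> p \<subseteq>\<^sub>m r \<or> r \<subseteq>\<^sub>m p"
      using S(1) r(1) unfolding chain_iff by auto
    have Cr: "p \<subseteq>\<^sub>m r" if "p \<in> ?C" for p
    proof -
      have "\<not> r \<subseteq>\<^sub>m p"
      proof
        assume "r \<subseteq>\<^sub>m p"
        hence "r \<subseteq>\<^sub>m x" using that by (auto intro: map_le_trans)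
        thus False using r ST by blast
      qed
      moreover have "p \<in> S" using that S(2) by (rule subsetD[rotated])
      ultimately show ?thesis using cmp by blast
    qed
    have "x i = r i" if "i \<in> dom x" for i
    proof -
      from ex[OF that] obtain p where "p \<in> ?C" "i \<in> dom p" by (elim bexE)
      thus ?thesis using Cr[of p] unfolding map_le_def by simp
    qed
    hence xr: "x \<subseteq>\<^sub>m r" by (simp add: map_le_def)
    have "r |` {..<h} = x"
    proof
      fix i
      show "(r |` {..<h}) i = x i"
      proof (cases "i < h")
        case True
        thus ?thesis using xr dx by (simp add: map_le_def)
      next
        case False
        hence "i \<notin> dom x" using dx by simp
        thus ?thesis using False by (simp add: domIff)
      qed
    qed
    thus False using tree_restrict[of r h] r(1) ST nin by auto
  qed
  hence "pred_on.maxchain T tree_less ?C"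
    using chain unfolding pred_on.maxchain_def by blast
  moreover have "Map.graph x = (\<Union>p\<in>?C. Map.graph p)"
  proof (intro equalityI subsetI)
    fix e assume "e \<in> Map.graph x"
    then obtain i b where e: "e = (i, b)" "x i = Some b" unfolding Map.graph_def by blast
    obtain p where p: "p \<in> ?C" "i \<in> dom p" using ex[of i] e(2) by auto
    hence "p i = Some b" using e(2) by (simp add: map_le_def)
    thus "e \<in> (\<Union>p\<in>?C. Map.graph p)" using e(1) p(1) by (auto simp: Map.graph_def)
  next
    fix e assume "e \<in> (\<Union>p\<in>?C. Map.graph p)"
    then obtain p i b where p: "p \<subseteq>\<^sub>m x" "p i = Some b" "e = (i, b)" by (auto simp: Map.graph_def)
    hence "x i = Some b" unfolding map_le_def by (metis domI)
    thus "e \<in> Map.graph x" using p(3) by (simp add: Map.graph_def)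
  qed
  ultimately show ?thesis unfolding branch_space_def by blast
qed

text \<open>Each place of x is reached by a vertex of the chain, whose restrictions are vertices
  too. If x were a vertex, any proper extension of it in T could be added to the chain.\<close>

lemma branch_props:
  assumes "x \<in> X"
  shows branch_dom: "dom x = {..<len x}"
    and branch_restrict: "\<And>i. i < len x \<Longrightarrow> x |` {..<i} \<in> T"
    and branch_notin: "x \<notin> T"
proof -
  obtain C where C: "pred_on.maxchain T tree_less C" and x: "Map.graph x = (\<Union>p\<in>C. Map.graph p)"
    using assms unfolding branch_space_def by blast
  show dx: "dom x = {..<len x}" by (rule len_branch(1)[OF tree C x])
  have eq: "tree_less\<^sup>=\<^sup>= p q \<longleftrightarrow> p \<subseteq>\<^sub>m q" for p q :: "'o \<rightharpoonup> bool"
    unfolding tree_less_def by (auto simp: map_le_refl)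
  have CT: "C \<subseteq> T" and cmp: "\<And>p q. p \<in> C \<Longrightarrow> q \<in> C \<Longrightarrow> p \<subseteq>\<^sub>m q \<or> q \<subseteq>\<^sub>m p"
    using C unfolding pred_on.maxchain_def pred_on.chain_def eq by auto
  have Cx: "p \<subseteq>\<^sub>m x" if "p \<in> C" for p
  proof -
    have "Map.graph p \<subseteq> Map.graph x" using x that by blast
    thus ?thesis by (force simp: Map.graph_def map_le_def)
  qed
  show "x |` {..<i} \<in> T" if i: "i < len x" for i
  proof -
    obtain b where "x i = Some b" using dx i by blast
    hence "(i, b) \<in> Map.graph x" by (simp add: Map.graph_def)
    then obtain p where p: "p \<in> C" "p i = Some b" unfolding x by (auto simp: Map.graph_def)
    have "i < len p" using p tree_dom[of p] CT by auto
    hence "x |` {..<i} = p |` {..<i}"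
      using Cx[OF p(1)] le_map_iff[of p x] p(1) CT by (auto simp: restrict_map_def fun_eq_iff)
    thus ?thesis using tree_restrict p(1) CT by auto
  qed
  show "x \<notin> T"
  proof
    assume "x \<in> T"
    then obtain r where r: "r \<in> T" "tree_less x r" using additive_tree_extend[OF tree] by blast
    have xr: "x \<subseteq>\<^sub>m r" "x \<noteq> r" using r(2) unfolding tree_less_def by auto
    have "p \<subseteq>\<^sub>m r" if "p \<in> C" for p using Cx[OF that] xr(1) by (rule map_le_trans)
    hence "pred_on.chain T tree_less (insert r C)"
      using CT cmp r(1) unfolding pred_on.chain_def eq by auto
    hence "r \<in> C" using C unfolding pred_on.maxchain_def by blast
    hence "r \<subseteq>\<^sub>m x" by (rule Cx)
    thus False using xr map_le_antisym by blast
  qed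
qed

lemma branch_len_le: "x \<in> X \<Longrightarrow> len x \<le> \<alpha>"
proof (rule ccontr)
  assume x: "x \<in> X" and "\<not> len x \<le> \<alpha>"
  hence a: "\<alpha> < len x" by simp
  have "len (x |` {..<\<alpha>}) = \<alpha>" by (rule len_eqI) (use a branch_dom[OF x] in auto)
  thus False using tree_len[OF branch_restrict[OF x a]] by simp
qed

lemma branch_restrict_atMost:
  assumes "x \<in> X" "i < len x"
  shows "x |` {..i} \<in> T" "len (x |` {..<i}) = i"
proof -
  show l: "len (x |` {..<i}) = i" by (rule len_eqI) (use assms branch_dom[OF assms(1)] in auto)
  obtain b where b: "x i = Some b" using assms branch_dom by blast
  have "x |` {..i} = (x |` {..<i})(i \<mapsto> b)" using b by (auto simp: restrict_map_def fun_eq_iff)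
  thus "x |` {..i} \<in> T" using tree_snoc[OF branch_restrict[OF assms], of b] l by simp
qed

text \<open>Otherwise x would be the restriction of y to \<open>len x\<close>, which is a vertex.
  Hence two distinct branches first differ at a place where both have digits, which makes the order
  total.\<close>

lemma branch_not_le:
  assumes "x \<in> X" "i \<notin> dom x" "\<And>j. j < i \<Longrightarrow> x j = y j" "y \<in> T \<or> y \<in> X \<and> i \<in> dom y"
  shows False
proof -
  have l: "len x \<le> i" using assms(2) branch_dom[OF assms(1)] by (simp add: not_less)
  have "x = y |` {..<len x}"
  proof
    fix k
    show "x k = (y |` {..<len x}) k"
    proof (cases "k < len x")
      case True
      thus ?thesis using assms(3)[of k] l by simp
    next
      case False
      hence "k \<notin> dom x" using branch_dom[OF assms(1)] by simp
      thus ?thesis using False by (simp add: domIff)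
    qed
  qed
  moreover have "y |` {..<len x} \<in> T"
    using assms(4)
  proof
    assume "y \<in> X \<and> i \<in> dom y"
    thus ?thesis using l branch_dom[of y] by (intro branch_restrict) auto
  qed (rule tree_restrict)
  ultimately show False using branch_notin[OF assms(1)] by simp
qed

lemma first_difference:
  assumes "x \<in> X" "y \<in> T \<or> y \<in> X" "x \<noteq> y"
  obtains i b where "\<And>j. j < i \<Longrightarrow> x j = y j" "x i = Some b" "y i \<noteq> Some b"
    "y \<in> X \<Longrightarrow> y i = Some (\<not> b)"
proof -
  define i where "i = (LEAST i. x i \<noteq> y i)"
  have "\<exists>i. x i \<noteq> y i" using assms(3) by auto
  hence i: "x i \<noteq> y i" unfolding i_def by (rule LeastI_ex)
  have eq: "x j = y j" if "j < i" for j using that not_less_Least unfolding i_def by blast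
  have "i \<in> dom x"
  proof (rule ccontr)
    assume "i \<notin> dom x"
    moreover from this have "i \<in> dom y" using i by (auto simp: domIff)
    ultimately show False using branch_not_le[OF assms(1)] eq assms(2) by blast
  qed
  then obtain b where b: "x i = Some b" by blast
  have "y i = Some (\<not> b)" if "y \<in> X"
  proof -
    have "i \<in> dom y"
      using branch_not_le[OF that, of i x] eq assms(1) \<open>i \<in> dom x\<close> by (metis (full_types))
    thus ?thesis using i b by auto
  qed
  thus ?thesis using that[of i b] eq b i by auto
qed

lemma lex_less_total:
  assumes "x \<in> X" "y \<in> X" "x \<noteq> y"
  shows "lex_less c x y \<or> lex_less c y x"
proof -
  obtain i b where i: "\<And>j. j < i \<Longrightarrow> x j = y j" "x i = Some b" "y i = Some (\<not> b)"
    using first_difference[OF assms(1) _ assms(3)] assms(2) by metis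
  show ?thesis
  proof (cases "b = c")
    case True
    have "lex_less c y x" by (rule lex_lessI[of i]) (use i True in auto)
    thus ?thesis ..
  next
    case False
    have "lex_less c x y" by (rule lex_lessI[of i]) (use i False in auto)
    thus ?thesis ..
  qed
qed

lemma branch_order_iff: "(x, y) \<in> branch_order T \<longleftrightarrow> x \<in> X \<and> y \<in> X \<and> lex_less True x y"
proof -
  have "\<epsilon> < len z" if "z \<in> X" "z \<epsilon> = Some b" for z b \<epsilon> using that branch_dom by blast
  thus ?thesis unfolding branch_order_def lex_less_def by auto
qed

lemma lots_branches: "lots X (branch_order T)"
  unfolding lots_def strict_linear_order_on_def
proof (intro conjI)
  show "branch_order T \<subseteq> X \<times> X" unfolding branch_order_def by auto
  show "trans (branch_order T)" using lex_less_trans by (auto simp: branch_order_iff intro!: transI)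
  show "irrefl (branch_order T)" using lex_less_irrefl by (auto simp: branch_order_iff irrefl_def)
  show "total_on X (branch_order T)"
    using lex_less_total by (auto simp: branch_order_iff total_on_def)
qed

sublocale lots_space X "branch_order T"
  by unfold_locales (rule lots_branches)

text \<open>Follow the digits of f until they leave the tree: h is the least length at which they
  do, and \<alpha> is such a length because vertices are shorter than \<alpha>.\<close>

lemma bits_branch_exists:
  obtains h where "bits f h \<in> X" "\<And>i. i < h \<Longrightarrow> bits f i \<in> T"
proof -
  define h where "h = (LEAST h. bits f h \<notin> T)"
  have "bits f \<alpha> \<notin> T" using tree_len[of "bits f \<alpha>"] len_bits[of f \<alpha>] by auto
  hence "bits f h \<notin> T" unfolding h_def by (rule LeastI)
  moreover have *: "bits f i \<in> T" if "i < h" for i using that not_less_Least unfolding h_def by blast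
  moreover have "bits f h |` {..<i} \<in> T" if "i < h" for i using * that by (simp add: bits_restrict)
  ultimately have "bits f h \<in> X" by (intro branchI[OF dom_bits])
  thus ?thesis using * that by blast
qed

text \<open>Turns the assumption on heights into usable form. Following the digit b gives some
  constant branch, and there is only one, since two distinct branches carry opposite digits at their
  first difference; so its length is \<alpha>.\<close>

lemma const_bits:
  shows const_bits_branch: "bits (\<lambda>_. b) \<alpha> \<in> X"
    and const_bits_tree: "\<And>i. i < \<alpha> \<Longrightarrow> bits (\<lambda>_. b) i \<in> T"
proof -
  obtain h where h: "bits (\<lambda>_. b) h \<in> X" "\<And>i. i < h \<Longrightarrow> bits (\<lambda>_. b) i \<in> T"
    using bits_branch_exists[of "\<lambda>_. b"] by metis
  have ran: "x i = Some d \<Longrightarrow> d = b" if "ran x \<subseteq> {b}" for x :: "'o \<rightharpoonup> bool" and i d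
    using that by (auto simp: ran_def)
  have "const_branch T b = bits (\<lambda>_. b) h"
    unfolding const_branch_def
  proof (rule the_equality)
    have r: "ran (bits (\<lambda>_. b) h) \<subseteq> {b}" unfolding bits_def ran_def by (auto split: if_splits)
    show "bits (\<lambda>_. b) h \<in> X \<and> ran (bits (\<lambda>_. b) h) \<subseteq> {b}" using h(1) r by blast
    fix x assume x: "x \<in> X \<and> ran x \<subseteq> {b}"
    show "x = bits (\<lambda>_. b) h"
    proof (rule ccontr)
      assume "x \<noteq> bits (\<lambda>_. b) h"
      then obtain i d where "x i = Some d" "bits (\<lambda>_. b) h i = Some (\<not> d)"
        using first_difference[of x "bits (\<lambda>_. b) h"] x h(1) by metis
      thus False using ran x r by blast
    qed
  qed
  hence "h = \<alpha>" using len_const_branch[of b] len_bits by metis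
  thus "bits (\<lambda>_. b) \<alpha> \<in> X" "\<And>i. i < \<alpha> \<Longrightarrow> bits (\<lambda>_. b) i \<in> T" using h by auto
qed

lemma branch_sup_exists:
  assumes S: "S \<subseteq> X"
  shows "\<exists>c\<in>X. (\<forall>s\<in>S. (c, s) \<notin> branch_order T) \<and>
    (\<forall>z. (z, c) \<in> branch_order T \<longrightarrow> (\<exists>s\<in>S. (z, s) \<in> branch_order T))"
proof -
  \<comment> \<open>Digit i of the supremum is 1 exactly when some member of S agrees with all
    earlier digits and has a 1 there; otherwise it is 0, the smallest choice. The digits may outlast
    the tree, so they are later cut off at a branch.\<close>
  define F where "F g i = (\<exists>s\<in>S. (\<forall>j<i. s j = Some (g j)) \<and> s i = Some True)" for g :: "'o \<Rightarrow> bool" and i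
  define f where "f = wfrec {(x, y). x < y} F"
  have wf: "wf {(x, y). x < (y::'o)}" by (rule wf)
  have f: "f i \<longleftrightarrow> (\<exists>s\<in>S. (\<forall>j<i. s j = Some (f j)) \<and> s i = Some True)" for i
  proof -
    have "f i = F (cut f {(x, y). x < y} i) i"
      unfolding f_def by (rule wfrec[OF wf])
    also have "\<dots> = F f i" unfolding F_def by (simp add: cut_def)
    finally show ?thesis by (simp add: F_def)
  qed
  obtain h where h: "bits f h \<in> X" using bits_branch_exists[of f] by metis
  have bits: "bits f h \<epsilon> = Some b \<Longrightarrow> f \<epsilon> = b \<and> (\<forall>j<\<epsilon>. bits f h j = Some (f j))" for \<epsilon> b
    unfolding bits_def by (auto split: if_splits)
  have "(bits f h, s) \<notin> branch_order T" if s: "s \<in> S" for s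
  proof
    assume "(bits f h, s) \<in> branch_order T"
    then obtain \<epsilon> where e: "\<forall>j<\<epsilon>. bits f h j = s j" "bits f h \<epsilon> = Some False" "s \<epsilon> = Some True"
      unfolding branch_order_iff lex_less_def by auto
    hence "\<not> f \<epsilon>" "\<forall>j<\<epsilon>. s j = Some (f j)" using bits[OF e(2)] by auto
    thus False using f[of \<epsilon>] s e(3) by blast
  qed
  moreover have "\<exists>s\<in>S. (z, s) \<in> branch_order T" if "(z, bits f h) \<in> branch_order T" for z
  proof -
    obtain \<epsilon> where e: "\<forall>j<\<epsilon>. z j = bits f h j" "z \<epsilon> = Some False" "bits f h \<epsilon> = Some True" and z: "z \<in> X"
      using \<open>(z, bits f h) \<in> branch_order T\<close> unfolding branch_order_iff lex_less_def by auto
    have "f \<epsilon>" and eq: "\<forall>j<\<epsilon>. bits f h j = Some (f j)" using bits[OF e(3)] by auto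
    then obtain s where s: "s \<in> S" "\<forall>j<\<epsilon>. s j = Some (f j)" "s \<epsilon> = Some True" using f[of \<epsilon>] by blast
    have "lex_less True z s" by (rule lex_lessI[of \<epsilon>]) (use s e eq in auto)
    thus ?thesis using s(1) S z by (auto simp: branch_order_iff)
  qed
  ultimately show ?thesis using h by blast
qed

lemma compact_branches: "compact_space \<tau>"
  using branch_sup_exists by (rule compact_space_if_sup)


subsection \<open>Cylinders\<close>

definition cylinder :: "('o \<rightharpoonup> bool) \<Rightarrow> ('o \<rightharpoonup> bool) set" where
  "cylinder p = {y \<in> X. p \<subseteq>\<^sub>m y}"

lemma cylinder_antimono: "p \<subseteq>\<^sub>m q \<Longrightarrow> cylinder q \<subseteq> cylinder p"
  unfolding cylinder_def by (auto intro: map_le_trans)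

lemma cylinder_empty: "cylinder Map.empty = X"
  unfolding cylinder_def by simp

lemma len_le_branch:
  assumes "p \<in> T" "p \<subseteq>\<^sub>m y" "dom y = {..<l}"
  shows "len p \<le> l"
  using map_le_implies_dom_le[OF assms(2)] tree_dom[OF assms(1)] assms(3) by simp

lemma tail_cat:
  assumes p: "p \<in> T" and x: "x \<in> X"
  shows "tail (len p) (cat p x) = x"
proof
  fix d
  show "tail (len p) (cat p x) d = x d"
  proof (cases "d \<in> ord_diff (len p) ` {len p..}")
    case True
    then obtain m where m: "len p \<le> m" "d = ord_diff (len p) m" by auto
    show ?thesis unfolding m(2) tail_ord_diff[OF m(1)] using m(1) by (simp add: cat_def leD)
  next
    case False
    \<comment> \<open>All places below \<alpha> are reachable by a shift, so an unreachable d lies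
      beyond the height of x and both sides are undefined there.\<close>
    hence "\<not> d < \<alpha>" using ord_add_exists[OF tree_len[OF p], of d] by auto
    hence "d \<notin> dom x" using branch_len_le[OF x] branch_dom[OF x] by auto
    thus ?thesis using tail_outside[OF False] by (simp add: domIff)
  qed
qed

text \<open>Both halves of additivity are used: concatenation keeps the proper initial parts in T,
  and if p + x were a vertex then so would be its tail x. That heights stay within \<alpha> is
  tail-likeness.\<close>

lemma cat_branch:
  assumes p: "p \<in> T" and x: "x \<in> X"
  shows "cat p x \<in> cylinder p"
proof -
  have dom: "k \<in> dom (cat p x) \<longleftrightarrow> k < len p \<or> ord_diff (len p) k < len x" for k
  proof (cases "k < len p")
    case True
    hence "k \<in> dom p" using tree_dom[OF p] by simp
    thus ?thesis using True by (simp add: cat_def domIff)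
  next
    case False
    have "k \<in> dom (cat p x) \<longleftrightarrow> ord_diff (len p) k \<in> dom x" using False by (simp add: cat_def domIff)
    thus ?thesis using False branch_dom[OF x] by simp
  qed
  have "\<exists>h. dom (cat p x) = {..<h}"
  proof (rule down_closed_eq_lessThan)
    show "\<alpha> \<notin> dom (cat p x)"
      using dom[of \<alpha>] tree_len[OF p] branch_len_le[OF x] ord_diff_height[OF tree_len[OF p]] by auto
    fix i j assume ij: "i < j" "j \<in> dom (cat p x)"
    show "i \<in> dom (cat p x)"
    proof (cases "i < len p")
      case False
      hence "ord_diff (len p) i < ord_diff (len p) j" using ij(1) by (simp add: ord_diff_less_iff)
      thus ?thesis using ij dom[of i] dom[of j] False by auto
    qed (use dom in blast)
  qed
  then obtain h where h: "dom (cat p x) = {..<h}" by blast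
  have "cat p x \<in> X"
  proof (rule branchI[OF h])
    fix i assume i: "i < h"
    show "cat p x |` {..<i} \<in> T"
    proof (cases "i \<le> len p")
      case True
      hence "cat p x |` {..<i} = p |` {..<i}" by (auto simp: cat_def restrict_map_def fun_eq_iff)
      thus ?thesis using tree_restrict[OF p] by simp
    next
      case False
      let ?d = "ord_diff (len p) i"
      have "i \<in> dom (cat p x)" using h i by simp
      hence "?d < len x" using dom[of i] False by (metis less_imp_le)
      moreover have "cat p x |` {..<i} = cat p (x |` {..<?d})"
        using False by (auto simp: cat_def restrict_map_def fun_eq_iff ord_diff_less_iff)
      ultimately show ?thesis using tree_cat[OF p branch_restrict[OF x]] by simp
    qed
  next
    show "cat p x \<notin> T"
    proof
      assume c: "cat p x \<in> T"
      have "len p \<le> len (cat p x)"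
        using len_le_branch[OF p le_map_cat[OF tree_dom[OF p]] tree_dom[OF c]] .
      hence "x \<in> T" using tree_tail[OF c, of "len p"] tail_cat[OF p x] by simp
      thus False using branch_notin[OF x] by simp
    qed
  qed
  thus ?thesis unfolding cylinder_def using le_map_cat[OF tree_dom[OF p]] by simp
qed

lemma tail_branch:
  assumes p: "p \<in> T" and y: "y \<in> cylinder p"
  shows "tail (len p) y \<in> X"
proof -
  have yX: "y \<in> X" and py: "p \<subseteq>\<^sub>m y" using y unfolding cylinder_def by auto
  show ?thesis
  proof (rule branchI[OF dom_tail[OF branch_dom[OF yX]]])
    fix i assume "i < ord_diff (len p) (len y)"
    then obtain m where m: "len p \<le> m" "m < len y" "ord_diff (len p) m = i"
      using ord_diff_surj by blast
    have "tail (len p) y |` {..<i} = tail (len p) (y |` {..<m})"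
    proof
      fix d
      show "(tail (len p) y |` {..<i}) d = tail (len p) (y |` {..<m}) d"
      proof (cases "d \<in> ord_diff (len p) ` {len p..}")
        case True
        then obtain k where k: "len p \<le> k" "d = ord_diff (len p) k" by auto
        have "d < i \<longleftrightarrow> k < m" using m k by (simp add: ord_diff_less_iff flip: m(3))
        thus ?thesis
          unfolding restrict_map_def k(2) tail_ord_diff[OF k(1)] lessThan_iff by simp
      next
        case False
        show ?thesis unfolding restrict_map_def tail_outside[OF False] by simp
      qed
    qed
    moreover have "tail (len p) (y |` {..<m}) \<in> T"
      using branch_restrict_atMost(2)[OF yX m(2)] m(1) by (intro tree_tail branch_restrict[OF yX m(2)]) simp
    ultimately show "tail (len p) y |` {..<i} \<in> T" by simp
  next
    show "tail (len p) y \<notin> T"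
      using tree_cat[OF p, of "tail (len p) y"] cat_tail[OF py tree_dom[OF p]] branch_notin[OF yX] by auto
  qed
qed

lemma lex_less_cat:
  assumes p: "p \<in> T" and x: "x \<in> X" and lt: "lex_less c x y"
  shows "lex_less c (cat p x) (cat p y)"
proof -
  obtain \<epsilon> where e: "\<forall>i<\<epsilon>. x i = y i" "x \<epsilon> = Some (\<not> c)" "y \<epsilon> = Some c"
    using lt unfolding lex_less_def by blast
  have "\<epsilon> \<in> dom x" using e(2) by blast
  hence "\<epsilon> < \<alpha>" using branch_dom[OF x] branch_len_le[OF x] by auto
  then obtain m where m: "len p \<le> m" "ord_diff (len p) m = \<epsilon>"
    using ord_add_exists[OF tree_len[OF p]] by blast
  show ?thesis
  proof (rule lex_lessI[of m])
    fix k assume "k < m"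
    hence "ord_diff (len p) k < \<epsilon>" if "\<not> k < len p"
      using that m by (simp add: ord_diff_less_iff flip: m(2))
    thus "cat p x k = cat p y k" using e(1) by (simp add: cat_def)
  qed (use m e in \<open>auto simp: cat_def\<close>)
qed

lemma cylinder_iso:
  assumes p: "p \<in> T"
  shows "order_isomorphic (lex_less c) (cylinder p) (lex_less c) X"
proof (rule order_isomorphic_sym)
  have "bij_betw (cat p) X (cylinder p)"
  proof (rule bij_betw_byWitness[where f' = "tail (len p)"])
    show "\<forall>x\<in>X. tail (len p) (cat p x) = x" using tail_cat[OF p] by blast
    show "\<forall>y\<in>cylinder p. cat p (tail (len p) y) = y"
      using cat_tail[OF _ tree_dom[OF p]] unfolding cylinder_def by simp
    show "cat p ` X \<subseteq> cylinder p" using cat_branch[OF p] by blast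
    show "tail (len p) ` cylinder p \<subseteq> X" using tail_branch[OF p] by blast
  qed
  moreover have "lex_less c x y \<longleftrightarrow> lex_less c (cat p x) (cat p y)" if "x \<in> X" "y \<in> X" for x y
    using lex_less_cat[OF p that(1), of c y] lex_less_cat[OF p that(2), of c x]
      lex_less_total[OF that, of c] lex_less_asym lex_less_irrefl by metis
  ultimately show "order_isomorphic (lex_less c) X (lex_less c) (cylinder p)"
    unfolding order_isomorphic_def by blast
qed

lemma cylinder_nonempty: "p \<in> T \<Longrightarrow> cylinder p \<noteq> {}"
  using cat_branch[OF _ const_bits_branch[of False]] by blast

lemma snoc_cylinder: "p \<in> T \<Longrightarrow> cylinder (p(len p \<mapsto> b)) = {y \<in> cylinder p. y (len p) = Some b}"
  unfolding cylinder_def by (auto simp: snoc_le_iff)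

lemma cylinder_two_points:
  assumes p: "p \<in> T"
  obtains y z where "y \<in> cylinder p" "z \<in> cylinder p" "y \<noteq> z"
proof -
  obtain y where "y \<in> cylinder (p(len p \<mapsto> False))" using cylinder_nonempty[OF tree_snoc[OF p]] by blast
  moreover obtain z where "z \<in> cylinder (p(len p \<mapsto> True))" using cylinder_nonempty[OF tree_snoc[OF p]] by blast
  ultimately show ?thesis unfolding snoc_cylinder[OF p] by (intro that[of y z]) auto
qed

text \<open>For a ray, keep x up to and including the place where x splits from the end point; this
  decides the comparison. Openness of the cylinder is not claimed, as it can fail at limit lengths;
  the inclusion suffices for perfectness.\<close>

lemma open_contains_cylinder:
  assumes "openin \<tau> U" "x \<in> U"
  shows "\<exists>p\<in>T. p \<subseteq>\<^sub>m x \<and> cylinder p \<subseteq> U"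
proof -
  have ray: "\<exists>p\<in>T. p \<subseteq>\<^sub>m x \<and> cylinder p \<subseteq> {y \<in> X. lex_less c a y}"
    if x: "x \<in> X" and ax: "lex_less c a x" for a c x
  proof -
    obtain \<epsilon> where e: "\<forall>i<\<epsilon>. a i = x i" "a \<epsilon> = Some (\<not> c)" "x \<epsilon> = Some c"
      using ax unfolding lex_less_def by blast
    have "\<epsilon> < len x" using e(3) branch_dom[OF x] by blast
    have "cylinder (x |` {..\<epsilon>}) \<subseteq> {y \<in> X. lex_less c a y}"
    proof
      fix y assume y: "y \<in> cylinder (x |` {..\<epsilon>})"
      hence "y k = x k" if "k \<le> \<epsilon>" for k
        using that \<open>\<epsilon> < len x\<close> branch_dom[OF x] unfolding cylinder_def map_le_def by auto
      hence "lex_less c a y" using e by (intro lex_lessI[of \<epsilon>]) auto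
      thus "y \<in> {y \<in> X. lex_less c a y}" using y unfolding cylinder_def by simp
    qed
    moreover have "x |` {..\<epsilon>} \<subseteq>\<^sub>m x" by (simp add: map_le_def)
    ultimately show ?thesis using branch_restrict_atMost(1)[OF x \<open>\<epsilon> < len x\<close>] by blast
  qed
  from assms(1) have "\<forall>x\<in>U. \<exists>p\<in>T. p \<subseteq>\<^sub>m x \<and> cylinder p \<subseteq> U"
  proof (induction rule: openin_lots_induct)
    case whole
    show ?case using empty_in_tree cylinder_empty by (intro ballI bexI[of _ Map.empty]) auto
  next
    case (above a)
    thus ?case using ray[of _ True a] by (simp add: branch_order_iff cong: conj_cong)
  next
    case (below a)
    thus ?case using ray[of _ False a] by (simp add: branch_order_iff lex_less_flip cong: conj_cong)
  next
    case (Int U V)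
    show ?case
    proof
      fix x assume x: "x \<in> U \<inter> V"
      obtain p q where p: "p \<in> T" "p \<subseteq>\<^sub>m x" "cylinder p \<subseteq> U" and q: "q \<in> T" "q \<subseteq>\<^sub>m x" "cylinder q \<subseteq> V"
        using Int x by blast
      have "dom p \<subseteq> dom q \<or> dom q \<subseteq> dom p" using tree_dom[OF p(1)] tree_dom[OF q(1)] by auto
      hence "p \<subseteq>\<^sub>m q \<or> q \<subseteq>\<^sub>m p" using map_le_of_common_upper p(2) q(2) by blast
      hence "cylinder q \<subseteq> cylinder p \<or> cylinder p \<subseteq> cylinder q" using cylinder_antimono by blast
      thus "\<exists>p\<in>T. p \<subseteq>\<^sub>m x \<and> cylinder p \<subseteq> U \<inter> V" using p q by blast
    qed
  next
    case (Union \<U>)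
    thus ?case by blast
  qed
  thus ?thesis using assms(2) by blast
qed

lemma perfect_branches: "perfect_lots X (branch_order T)"
  unfolding perfect_lots_def
proof (intro ballI notI)
  fix x assume "openin \<tau> {x}"
  then obtain p where p: "p \<in> T" "cylinder p \<subseteq> {x}" using open_contains_cylinder by blast
  obtain y z where "y \<in> cylinder p" "z \<in> cylinder p" "y \<noteq> z" by (rule cylinder_two_points[OF p(1)])
  thus False using p(2) by blast
qed

section \<open>Splitting and convexity of cylinders\<close>

lemma cylinder_split: "s \<in> T \<Longrightarrow> cylinder s = cylinder (s(len s \<mapsto> False)) \<union> cylinder (s(len s \<mapsto> True))"
proof -
  assume s: "s \<in> T"
  have "\<exists>b. y (len s) = Some b" if y: "y \<in> cylinder s" for y
  proof (rule ccontr)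
    assume "\<not> ?thesis"
    hence "len s \<notin> dom y" by (simp add: domIff)
    moreover have "y \<in> X" and "\<And>j. j < len s \<Longrightarrow> y j = s j"
      using y le_map_iff[OF s] unfolding cylinder_def by auto
    ultimately show False using branch_not_le[of y "len s" s] s by blast
  qed
  thus ?thesis unfolding snoc_cylinder[OF s] by (auto, metis (full_types))
qed

text \<open>At the first place where y leaves s, being beyond a forces the digit c while being
  before b forces the opposite digit.\<close>

lemma cylinder_convex:
  assumes s: "s \<in> T" and a: "a \<in> cylinder s" and b: "b \<in> cylinder s" and y: "y \<in> X"
    and ay: "lex_less c a y" and yb: "lex_less c y b"
  shows "y \<in> cylinder s"
proof (rule ccontr)
  assume "y \<notin> cylinder s"
  hence ex: "\<exists>i. i < len s \<and> y i \<noteq> s i" using y le_map_iff[OF s, of y] unfolding cylinder_def by auto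
  define i where "i = (LEAST i. i < len s \<and> y i \<noteq> s i)"
  have i: "i < len s" "y i \<noteq> s i" using LeastI_ex[OF ex] unfolding i_def by auto
  have eq: "y k = s k" if "k < i" for k
    using not_less_Least[of k "\<lambda>i. i < len s \<and> y i \<noteq> s i"] that i(1) unfolding i_def by auto
  have ab: "a k = s k" "b k = s k" if "k < len s" for k
    using a b that le_map_iff[OF s] unfolding cylinder_def by auto
  obtain \<delta> where d: "\<forall>k<\<delta>. a k = y k" "a \<delta> = Some (\<not> c)" "y \<delta> = Some c"
    using ay unfolding lex_less_def by blast
  have "\<not> \<delta> < i"
  proof
    assume "\<delta> < i"
    hence "a \<delta> = y \<delta>" using ab(1)[of \<delta>] eq[of \<delta>] i(1) by simp
    thus False using d(2,3) by simp
  qed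
  moreover have "\<not> i < \<delta>" using d(1) ab(1)[OF i(1)] i(2) by auto
  ultimately have "y i = Some c" using d(3) by (cases i \<delta> rule: linorder_cases) auto
  obtain \<epsilon> where e: "\<forall>k<\<epsilon>. y k = b k" "y \<epsilon> = Some (\<not> c)" "b \<epsilon> = Some c"
    using yb unfolding lex_less_def by blast
  have "\<not> \<epsilon> < i"
  proof
    assume "\<epsilon> < i"
    hence "b \<epsilon> = y \<epsilon>" using ab(2)[of \<epsilon>] eq[of \<epsilon>] i(1) by simp
    thus False using e(2,3) by simp
  qed
  moreover have "\<not> i < \<epsilon>" using e(1) ab(2)[OF i(1)] i(2) by auto
  ultimately have "y i = Some (\<not> c)" using e(2) by (cases i \<epsilon> rule: linorder_cases) auto
  thus False using \<open>y i = Some c\<close> by simp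
qed


subsection \<open>Cuts at vertices\<close>

text \<open>A vertex \<open>q\<close> cuts the branch space into two clopen segments: the branches passing \<open>q\<close> on the
  left or extending \<open>q + 0\<close>, and those passing \<open>q\<close> on the right or extending \<open>q + 1\<close>.\<close>

definition side :: "bool \<Rightarrow> ('o \<rightharpoonup> bool) \<Rightarrow> ('o \<rightharpoonup> bool) set" where
  "side c q = {y \<in> X. \<exists>j. (\<forall>i<j. y i = q i) \<and> y j = Some c \<and> q j \<noteq> Some c}"

lemma sideI: "y \<in> X \<Longrightarrow> (\<And>i. i < j \<Longrightarrow> y i = q i) \<Longrightarrow> y j = Some c \<Longrightarrow> q j \<noteq> Some c \<Longrightarrow> y \<in> side c q"
  unfolding side_def by blast

lemma side_subset: "side c q \<subseteq> X"
  unfolding side_def by blast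

lemma side_cover:
  assumes q: "q \<in> T" and y: "y \<in> X"
  shows "y \<in> side c q \<or> y \<in> side (\<not> c) q"
proof -
  have "y \<noteq> q" using branch_notin[OF y] q by blast
  then obtain i b where i: "\<And>j. j < i \<Longrightarrow> y j = q j" "y i = Some b" "q i \<noteq> Some b"
    using first_difference[OF y] q by metis
  hence "y \<in> side b q" using y by (intro sideI)
  thus ?thesis by (cases "b = c") auto
qed

lemma side_less:
  assumes y: "y \<in> side (\<not> c) q" and z: "z \<in> side c q"
  shows "lex_less c y z"
proof -
  obtain j where j: "\<forall>i<j. y i = q i" "y j = Some (\<not> c)" "q j \<noteq> Some (\<not> c)" and yX: "y \<in> X"
    using y unfolding side_def by blast
  obtain k where k: "\<forall>i<k. z i = q i" "z k = Some c" "q k \<noteq> Some c" and zX: "z \<in> X"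
    using z unfolding side_def by blast
  \<comment> \<open>The earlier of the two exits decides: the branch that is still following q has a
    digit there, and it differs from the digit of the one that leaves.\<close>
  consider "j < k" | "k < j" | "j = k" by fastforce
  thus ?thesis
  proof cases
    case 1
    have "k \<in> dom z" using k(2) by blast
    hence "j \<in> dom z" using 1 branch_dom[OF zX] by auto
    then obtain b where b: "z j = Some b" by blast
    hence "z j = Some c" using k(1) 1 j(3) by (cases "b = c") auto
    thus ?thesis using j k 1 by (intro lex_lessI[of j]) auto
  next
    case 2
    have "j \<in> dom y" using j(2) by blast
    hence "k \<in> dom y" using 2 branch_dom[OF yX] by auto
    then obtain b where b: "y k = Some b" by blast
    hence "y k = Some (\<not> c)" using j(1) 2 k(3) by (cases "b = c") auto
    thus ?thesis using j k 2 by (intro lex_lessI[of k]) auto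
  next
    case 3
    thus ?thesis using j k by (intro lex_lessI[of k]) auto
  qed
qed

lemma side_Compl: "q \<in> T \<Longrightarrow> side c q = X - side (\<not> c) q"
  using side_cover[of q _ c] side_subset[of c q] side_less[of _ c q] lex_less_irrefl by blast

lemma openin_ray: "a \<in> X \<Longrightarrow> openin \<tau> {y \<in> X. lex_less c a y}"
proof (cases c)
  case True
  assume "a \<in> X"
  thus ?thesis using openin_above[of a] True by (simp add: branch_order_iff cong: conj_cong)
next
  case False
  assume "a \<in> X"
  thus ?thesis using openin_below[of a] False by (simp add: branch_order_iff lex_less_flip cong: conj_cong)
qed

text \<open>The witness is the last point before the cut in direction c: q, then \<not> c, then c
  for ever (q0111... when c is \<open>True\<close>). It shows that the side is open, and the same
  for the opposite digit makes it closed.\<close>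

lemma side_eq_ray:
  assumes q: "q \<in> T"
  obtains a where "a \<in> X" "side c q = {y \<in> X. lex_less c a y}"
proof -
  let ?p = "q(len q \<mapsto> \<not> c)"
  define a where "a = cat ?p (bits (\<lambda>_. c) \<alpha>)"
  have p: "?p \<in> T" using tree_snoc[OF q] .
  have "a \<in> cylinder ?p" unfolding a_def by (rule cat_branch[OF p const_bits_branch])
  hence a: "a \<in> X" "\<And>i. i < len q \<Longrightarrow> a i = q i" "a (len q) = Some (\<not> c)"
    by (simp_all add: cylinder_def snoc_le_iff[OF q] le_map_iff[OF q])
  have "len q \<notin> dom q" unfolding tree_dom[OF q] by simp
  hence qlen: "q (len q) = None" by (simp add: domIff)
  have lenp: "i < len ?p \<longleftrightarrow> i \<le> len q" for i
  proof -
    have "i \<in> dom ?p \<longleftrightarrow> i \<in> {..len q}" using dom_snoc[OF q] by simp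
    thus ?thesis unfolding tree_dom[OF p] by simp
  qed
  \<comment> \<open>Beyond q the point a has no digit \<not> c left, so anything beyond a must
    differ from it at \<open>len q\<close> or earlier.\<close>
  have later: "a i = Some c \<or> a i = None" if "len q < i" for i
    using lenp[of i] that unfolding a_def cat_def bits_def by auto
  have "a \<in> side (\<not> c) q" by (rule sideI[of a "len q"]) (use a qlen in auto)
  hence "side c q \<subseteq> {y \<in> X. lex_less c a y}" using side_less side_subset by blast
  moreover have "y \<in> side c q" if y: "y \<in> X" "lex_less c a y" for y
  proof -
    obtain \<epsilon> where e: "\<forall>i<\<epsilon>. a i = y i" "a \<epsilon> = Some (\<not> c)" "y \<epsilon> = Some c"
      using y(2) unfolding lex_less_def by blast
    have "\<epsilon> \<le> len q" using later[of \<epsilon>] e(2) by (cases "len q < \<epsilon>") auto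
    thus ?thesis using y(1) a e qlen
      by (intro sideI[of y \<epsilon>]) (auto simp: order.order_iff_strict)
  qed
  ultimately show ?thesis using a(1) that by blast
qed

lemma clopen_convex_side:
  assumes q: "q \<in> T"
  shows "clopen_convex X (branch_order T) (side c q)"
proof -
  have op: "openin \<tau> (side c q)" for c
    using side_eq_ray[OF q, of c] openin_ray by metis
  have "closedin \<tau> (X - side (\<not> c) q)"
    using closedin_diff[OF closedin_topspace op] by simp
  hence "closedin \<tau> (side c q)" by (subst side_Compl[OF q])
  moreover have "order_convex X (branch_order T) (side c q)"
    unfolding order_convex_def
  proof (intro conjI ballI impI side_subset)
    fix u v y assume uv: "u \<in> side c q" "v \<in> side c q" and y: "y \<in> X"
      and lt: "(u, y) \<in> branch_order T \<and> (y, v) \<in> branch_order T"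
    have "y \<notin> side (\<not> c) q"
    proof
      assume "y \<in> side (\<not> c) q"
      hence "lex_less c y u" "lex_less c y v" using uv side_less by auto
      moreover have "lex_less True u y" "lex_less True y v" using lt by (simp_all add: branch_order_iff)
      ultimately show False
        using lex_less_asym[of True u y] lex_less_asym[of True y v] lex_less_flip by (cases c) auto
    qed
    thus "y \<in> side c q" using side_cover[OF q y] by blast
  qed
  ultimately show ?thesis using op unfolding clopen_convex_def by blast
qed

text \<open>The cut is taken at the common initial part of the two branches. Describing it as a
  restriction of x matters: the cuts around x are then indexed by a digit and a place below
  \<open>len x\<close>, hence are countably many if \<alpha> is countable.\<close>

lemma side_separates:
  assumes x: "x \<in> X" and a: "a \<in> X" and lt: "lex_less c a x"
  obtains i where "i < len x" "x \<in> side c (x |` {..<i})" "a \<in> side (\<not> c) (x |` {..<i})"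
proof -
  obtain \<epsilon> where e: "\<forall>i<\<epsilon>. a i = x i" "a \<epsilon> = Some (\<not> c)" "x \<epsilon> = Some c"
    using lt unfolding lex_less_def by blast
  have "\<epsilon> < len x" using e(3) branch_dom[OF x] by blast
  moreover have "x \<in> side c (x |` {..<\<epsilon>})" by (rule sideI[of x \<epsilon>]) (use x e in auto)
  moreover have "a \<in> side (\<not> c) (x |` {..<\<epsilon>})" by (rule sideI[of a \<epsilon>]) (use a e in auto)
  ultimately show ?thesis by (rule that)
qed

section \<open>Neighbourhood bases made of cuts\<close>

definition cut_neighbourhoods :: "('o \<rightharpoonup> bool) \<Rightarrow> ('o \<rightharpoonup> bool) set set" where
  "cut_neighbourhoods x = {S. x \<in> S \<and> (\<exists>c. \<exists>i<len x. S = side c (x |` {..<i}))}"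

lemma cut_neighbourhood_ray:
  assumes x: "x \<in> X" and a: "a \<in> X" and lt: "lex_less c a x"
  shows "\<exists>S\<in>cut_neighbourhoods x. S \<subseteq> {y \<in> X. lex_less c a y}"
proof -
  obtain i where i: "i < len x" "x \<in> side c (x |` {..<i})" "a \<in> side (\<not> c) (x |` {..<i})"
    using side_separates[OF assms] by blast
  have "side c (x |` {..<i}) \<subseteq> {y \<in> X. lex_less c a y}" using side_less[OF i(3)] side_subset by blast
  thus ?thesis using i(1,2) unfolding cut_neighbourhoods_def by blast
qed

text \<open>Cuts from both directions have to be combined, so finite intersections are needed. The
  intersection with X covers the empty family, where \<open>\<Inter>{}\<close> is the whole
  type.\<close>

lemma open_contains_cuts:
  assumes "openin \<tau> U" "x \<in> U"
  shows "\<exists>F. finite F \<and> F \<subseteq> cut_neighbourhoods x \<and> X \<inter> \<Inter>F \<subseteq> U"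
proof -
  let ?P = "\<lambda>x U. \<exists>F. finite F \<and> F \<subseteq> cut_neighbourhoods x \<and> X \<inter> \<Inter>F \<subseteq> U"
  have ray: "?P x {y \<in> X. lex_less c a y}" if "x \<in> X" "a \<in> X" "lex_less c a x" for a c x
  proof -
    from cut_neighbourhood_ray[OF that]
    obtain S where "S \<in> cut_neighbourhoods x" "S \<subseteq> {y \<in> X. lex_less c a y}" by blast
    thus ?thesis by (intro exI[of _ "{S}"]) auto
  qed
  from assms(1) have "\<forall>x\<in>U. ?P x U"
  proof (induction rule: openin_lots_induct)
    case whole
    show ?case by (intro ballI exI[of _ "{}"]) auto
  next
    case (above a)
    thus ?case using ray[of _ a True] by (simp add: branch_order_iff cong: conj_cong)
  next
    case (below a)
    thus ?case using ray[of _ a False] by (simp add: branch_order_iff lex_less_flip cong: conj_cong)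
  next
    case (Int U V)
    show ?case
    proof
      fix x assume x: "x \<in> U \<inter> V"
      from bspec[OF Int(1) IntD1[OF x]]
      obtain F where F: "finite F" "F \<subseteq> cut_neighbourhoods x" "X \<inter> \<Inter>F \<subseteq> U" by (elim exE conjE)
      from bspec[OF Int(2) IntD2[OF x]]
      obtain G where G: "finite G" "G \<subseteq> cut_neighbourhoods x" "X \<inter> \<Inter>G \<subseteq> V" by (elim exE conjE)
      have "X \<inter> \<Inter>(F \<union> G) \<subseteq> U \<inter> V" using F(3) G(3) by blast
      thus "?P x (U \<inter> V)" using F(1,2) G(1,2) by (intro exI[of _ "F \<union> G"]) simp
    qed
  next
    case (Union \<U>)
    show ?case
    proof
      fix x assume "x \<in> \<Union>\<U>"
      then obtain U where U: "U \<in> \<U>" "x \<in> U" by blast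
      from bspec[OF Union[OF U(1)] U(2)]
      obtain F where F: "finite F" "F \<subseteq> cut_neighbourhoods x" "X \<inter> \<Inter>F \<subseteq> U" by (elim exE conjE)
      have "X \<inter> \<Inter>F \<subseteq> \<Union>\<U>" using F(3) U(1) by blast
      thus "?P x (\<Union>\<U>)" using F(1,2) by (intro exI[of _ F]) simp
    qed
  qed
  thus ?thesis using assms(2) by (rule bspec)
qed

lemma clopen_convex_cuts:
  assumes x: "x \<in> X" and F: "finite F" "F \<subseteq> cut_neighbourhoods x"
  shows "clopen_convex X (branch_order T) (X \<inter> \<Inter>F)"
  using F
proof (induction rule: finite_induct)
  case empty
  show ?case using clopen_convex_whole by simp
next
  case (insert S F)
  then obtain c i where "i < len x" "S = side c (x |` {..<i})" unfolding cut_neighbourhoods_def by blast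
  hence "clopen_convex X (branch_order T) S" using clopen_convex_side[OF branch_restrict[OF x]] by simp
  moreover have "X \<inter> \<Inter>(insert S F) = S \<inter> (X \<inter> \<Inter>F)" by blast
  ultimately show ?case using insert clopen_convex_Int by simp
qed

lemma zero_dimensional_branches: "zero_dimensional_lots X (branch_order T)"
  unfolding zero_dimensional_lots_def
proof (intro allI impI, elim conjE)
  fix U x assume U: "openin \<tau> U" "x \<in> U"
  have x: "x \<in> X" using U openin_subset by fastforce
  obtain F where F: "finite F" "F \<subseteq> cut_neighbourhoods x" "X \<inter> \<Inter>F \<subseteq> U"
    using open_contains_cuts[OF U] by blast
  have "x \<in> X \<inter> \<Inter>F" using F(2) x unfolding cut_neighbourhoods_def by blast
  thus "\<exists>J. clopen_convex X (branch_order T) J \<and> x \<in> J \<and> J \<subseteq> U"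
    using clopen_convex_cuts[OF x F(1,2)] F(3) by blast
qed

lemma first_countable_branches:
  assumes "countable {..<\<alpha>}"
  shows "first_countable \<tau>"
  unfolding first_countable_def
proof
  fix x assume "x \<in> topspace \<tau>"
  hence x: "x \<in> X" by simp
  have "cut_neighbourhoods x \<subseteq> (\<lambda>(c, i). side c (x |` {..<i})) ` (UNIV \<times> {..<\<alpha>})"
  proof
    fix S assume "S \<in> cut_neighbourhoods x"
    then obtain c i where "i < len x" "S = side c (x |` {..<i})" unfolding cut_neighbourhoods_def by blast
    thus "S \<in> (\<lambda>(c, i). side c (x |` {..<i})) ` (UNIV \<times> {..<\<alpha>})"
      using branch_len_le[OF x] by (intro image_eqI[of _ _ "(c, i)"]) auto
  qed
  moreover have "countable ((\<lambda>(c, i). side c (x |` {..<i})) ` (UNIV \<times> {..<\<alpha>}))"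
    using assms by (intro countable_image countable_SIGMA) auto
  ultimately have "countable (cut_neighbourhoods x)" by (rule countable_subset)
  hence "countable {F. finite F \<and> F \<subseteq> cut_neighbourhoods x}" by (rule countable_Collect_finite_subset)
  hence "countable ((\<lambda>F. X \<inter> \<Inter>F) ` {F. finite F \<and> F \<subseteq> cut_neighbourhoods x})" (is "countable ?B")
    by (rule countable_image)
  moreover have "\<forall>V\<in>?B. openin \<tau> V"
    using clopen_convex_cuts[OF x] unfolding clopen_convex_def by blast
  moreover have "\<exists>V\<in>?B. x \<in> V \<and> V \<subseteq> U" if U: "openin \<tau> U" "x \<in> U" for U
  proof -
    obtain F where F: "finite F" "F \<subseteq> cut_neighbourhoods x" "X \<inter> \<Inter>F \<subseteq> U"
      using open_contains_cuts[OF U] by blast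
    have "x \<in> X \<inter> \<Inter>F" using F(2) x unfolding cut_neighbourhoods_def by blast
    thus ?thesis using F by (intro bexI[of _ "X \<inter> \<Inter>F"]) auto
  qed
  ultimately show "\<exists>B. countable B \<and> (\<forall>V\<in>B. openin \<tau> V) \<and>
      (\<forall>U. openin \<tau> U \<and> x \<in> U \<longrightarrow> (\<exists>V\<in>B. x \<in> V \<and> V \<subseteq> U))"
    by (intro exI[of _ ?B]) blast
qed

text \<open>Let \<open>\<beta>\<close> be the order type of the set \<open>Z\<close> of those places of \<open>q\<close> beyond \<open>p\<close> at which a branch can
  leave \<open>q\<close> to the side \<open>c\<close>.  Leaving at the \<open>j\<close>-th such place corresponds to leaving the constant branch
  \<open>\<not> c\<close> at \<open>j\<close>, and the branches extending \<open>q + c\<close> correspond to those which do not leave it before \<open>\<beta>\<close>.\<close>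

lemma cylinder_Int_side_iso_le:
  assumes p: "p \<in> T" and q: "q \<in> T" and pq: "p \<subseteq>\<^sub>m q"
  shows "order_isomorphic (lex_less c) (cylinder p \<inter> side c q) (lex_less c) X"
proof -
  define Z where "Z = {z. len p \<le> z \<and> z < len q \<and> q z = Some (\<not> c)}"
  \<comment> \<open>The extra index \<open>len q\<close> stands for the exit just past the end of q,
    that is for the branches extending q + c.\<close>
  define I where "I = insert (len q) Z"
  define g where "g = order_type Z"
  let ?bits = "bits (\<lambda>_. \<not> c)"
  define P where "P z = (q |` {..<z})(z \<mapsto> c)" for z
  \<comment> \<open>At the last index no digit c is appended: whatever follows (\<not> c)^\<beta>
    belongs to that summand, since the sum has to exhaust X. The summand is still a copy of
    X.\<close>
  define Q where "Q z = (if z = len q then ?bits (g z) else (?bits (g z))(g z \<mapsto> c))" for z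
  have Iq: "z \<le> len q" if "z \<in> I" for z using that unfolding I_def Z_def by auto
  have IZ: "z \<in> Z" if "z \<in> I" "z < len q" for z using that unfolding I_def by auto
  have len_le: "len p \<le> len q" using len_le_branch[OF p pq tree_dom[OF q]] .
  have Ip: "len p \<le> z" if "z \<in> I" for z using that len_le unfolding I_def Z_def by auto
  have bits_T: "?bits (g z) \<in> T" if "z \<in> I" for z
  proof -
    \<comment> \<open>Collapsing cannot increase places, so the coding word is no longer than q;
      being constant and shorter than \<alpha>, it is a vertex.\<close>
    have "g z \<le> len q" using order_type_le[of Z z] Iq[OF that] unfolding g_def by simp
    thus ?thesis using tree_len[OF q] by (intro const_bits_tree) simp
  qed
  have lenr: "len (q |` {..<z}) = z" if "z \<le> len q" for z
    by (rule len_eqI) (use tree_dom[OF q] that in auto)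
  have P_T: "P z \<in> T" if "z \<in> I" for z
    using tree_snoc[OF tree_restrict[OF q], of z c] lenr[OF Iq[OF that]] by (simp add: P_def)
  have Q_T: "Q z \<in> T" if "z \<in> I" for z
    using tree_snoc[OF bits_T[OF that], of c] bits_T[OF that]
    by (cases "z = len q") (simp_all add: Q_def len_bits)
  have P_iff: "y \<in> cylinder (P z) \<longleftrightarrow> y \<in> X \<and> (\<forall>k<z. y k = q k) \<and> y z = Some c" if z: "z \<in> I" for y z
  proof -
    have "P z \<subseteq>\<^sub>m y \<longleftrightarrow> q |` {..<z} \<subseteq>\<^sub>m y \<and> y z = Some c"
      using snoc_le_iff[OF tree_restrict[OF q], of z c y] lenr[OF Iq[OF z]] by (simp add: P_def)
    also have "q |` {..<z} \<subseteq>\<^sub>m y \<longleftrightarrow> (\<forall>k<z. q k = y k)"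
      using le_map_iff[OF tree_restrict[OF q], of z y] lenr[OF Iq[OF z]] by simp
    finally show ?thesis by (auto simp: cylinder_def)
  qed
  have bits_le: "?bits (g z) \<subseteq>\<^sub>m y \<longleftrightarrow> (\<forall>k<g z. y k = Some (\<not> c))" if z: "z \<in> I" for y z
  proof -
    have "?bits (g z) \<subseteq>\<^sub>m y \<longleftrightarrow> (\<forall>k<g z. ?bits (g z) k = y k)"
      using le_map_iff[OF bits_T[OF z], of y] unfolding len_bits .
    thus ?thesis by (auto simp: bits_def)
  qed
  have Q_iff: "y \<in> cylinder (Q z) \<longleftrightarrow> y \<in> X \<and> (\<forall>k<g z. y k = Some (\<not> c)) \<and> (z \<noteq> len q \<longrightarrow> y (g z) = Some c)"
    if z: "z \<in> I" for y z
    using snoc_le_iff[OF bits_T[OF z], of c y] bits_le[OF z, of y]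
    by (auto simp: cylinder_def Q_def len_bits)
  have P_cover: "(\<Union>z\<in>I. cylinder (P z)) = cylinder p \<inter> side c q"
  proof (intro equalityI subsetI)
    fix y assume "y \<in> (\<Union>z\<in>I. cylinder (P z))"
    then obtain z where z: "z \<in> I" "y \<in> X" "\<forall>k<z. y k = q k" "y z = Some c" using P_iff by blast
    have "z \<notin> dom q \<or> q z = Some (\<not> c)"
      using z(1) tree_dom[OF q] unfolding I_def Z_def by auto
    hence "q z \<noteq> Some c" by auto
    hence "y \<in> side c q" using z by (intro sideI[of y z]) auto
    moreover have "p \<subseteq>\<^sub>m y"
      using pq le_map_iff[OF p] Ip[OF z(1)] z(3) by auto
    ultimately show "y \<in> cylinder p \<inter> side c q" using z(2) by (simp add: cylinder_def)
  next
    fix y assume "y \<in> cylinder p \<inter> side c q"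
    then obtain j where y: "y \<in> X" "p \<subseteq>\<^sub>m y" and j: "\<forall>i<j. y i = q i" "y j = Some c" "q j \<noteq> Some c"
      unfolding cylinder_def side_def by blast
    have "\<not> j < len p"
      using le_map_iff[OF p, of y] le_map_iff[OF p, of q] pq y(2) j(2,3) by auto
    moreover have "\<not> len q < j"
    proof
      assume "len q < j"
      moreover have "j \<in> dom y" using j(2) by blast
      ultimately have "len q \<in> dom y" using branch_dom[OF y(1)] by auto
      hence "len q \<in> dom q" using j(1) \<open>len q < j\<close> by (auto simp: domIff)
      thus False using tree_dom[OF q] by simp
    qed
    moreover have "q j = Some (\<not> c)" if "j < len q"
    proof -
      have "j \<in> dom q" using that tree_dom[OF q] by simp
      thus ?thesis using j(3) by auto
    qed
    ultimately have "j \<in> I" unfolding I_def Z_def by (cases "j = len q") auto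
    thus "y \<in> (\<Union>z\<in>I. cylinder (P z))" using P_iff y(1) j(1,2) by blast
  qed
  have Q_cover: "(\<Union>z\<in>I. cylinder (Q z)) = X"
  proof (intro equalityI subsetI)
    fix y assume y: "y \<in> X"
    have lI: "len q \<in> I" unfolding I_def by simp
    have "y \<noteq> ?bits (g (len q))" using branch_notin[OF y] bits_T[OF lI] by blast
    then obtain i b where i: "\<And>j. j < i \<Longrightarrow> y j = ?bits (g (len q)) j" "y i = Some b"
        "?bits (g (len q)) i \<noteq> Some b"
      using first_difference[OF y] bits_T[OF lI] by metis
    show "y \<in> (\<Union>z\<in>I. cylinder (Q z))"
    proof (cases "i < g (len q)")
      case True
      \<comment> \<open>The values of the collapse have no gaps, so an exit from the constant word
        before \<beta> is the image of an actual exit place of q.\<close>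
      hence "i \<in> g ` (Z \<inter> {..<len q})" using order_type_image[of Z "len q"] unfolding g_def by auto
      then obtain z where z: "z \<in> Z" "i = g z" "z < len q" by auto
      have "b = c" using i(3) True by (auto simp: bits_def)
      moreover have "y k = Some (\<not> c)" if "k < g z" for k
        using i(1)[of k] that z(2) True by (simp add: bits_def)
      ultimately have "y \<in> cylinder (Q z)" using Q_iff[of z y] y z i(2) unfolding I_def by auto
      thus ?thesis using z(1) unfolding I_def by blast
    next
      case False
      hence "y k = Some (\<not> c)" if "k < g (len q)" for k
        using i(1)[of k] that by (simp add: bits_def)
      thus ?thesis using Q_iff[OF lI, of y] y lI by blast
    qed
  qed (auto simp: cylinder_def)
  \<comment> \<open>An earlier exit lies farther in direction c, so the summands descend as the
    index grows; gluing is applied to the reversed relations.\<close>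
  have "order_isomorphic (\<lambda>x y. lex_less c y x) (\<Union>z\<in>I. cylinder (P z)) (\<lambda>x y. lex_less c y x) (\<Union>z\<in>I. cylinder (Q z))"
  proof (rule order_isomorphic_UN)
    fix z assume "z \<in> I"
    hence "order_isomorphic (lex_less c) (cylinder (P z)) (lex_less c) (cylinder (Q z))"
      by (intro order_isomorphic_trans[OF cylinder_iso order_isomorphic_sym[OF cylinder_iso]] P_T Q_T)
    thus "order_isomorphic (\<lambda>x y. lex_less c y x) (cylinder (P z)) (\<lambda>x y. lex_less c y x) (cylinder (Q z))"
      by (rule order_isomorphic_converse[THEN iffD2])
  next
    fix i j x y assume ij: "i \<in> I" "j \<in> I" "i < j" and x: "x \<in> cylinder (P i)" and y: "y \<in> cylinder (P j)"
    have "i < len q" using ij(3) Iq[OF ij(2)] by (rule less_le_trans)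
    hence "i \<in> Z" by (rule IZ[OF ij(1)])
    hence "q i = Some (\<not> c)" unfolding Z_def by simp
    moreover have "\<forall>k<i. x k = q k" "x i = Some c" using x P_iff[OF ij(1), of x] by auto
    moreover have "\<forall>k<j. y k = q k" using y P_iff[OF ij(2), of y] by auto
    ultimately have "lex_less c y x" using ij(3) by (intro lex_lessI[of i]) auto
    thus "lex_less c y x \<and> \<not> lex_less c x y" using lex_less_asym by blast
  next
    fix i j x y assume ij: "i \<in> I" "j \<in> I" "i < j" and x: "x \<in> cylinder (Q i)" and y: "y \<in> cylinder (Q j)"
    have iq: "i < len q" using ij(3) Iq[OF ij(2)] by (rule less_le_trans)
    hence "i \<in> Z" by (rule IZ[OF ij(1)])
    hence "g i < g j" using ij(3) unfolding g_def by (rule order_type_less)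
    moreover have "\<forall>k<g i. x k = Some (\<not> c)" "x (g i) = Some c" using x Q_iff[OF ij(1), of x] iq by auto
    moreover have "\<forall>k<g j. y k = Some (\<not> c)" using y Q_iff[OF ij(2), of y] by auto
    ultimately have "lex_less c y x" by (intro lex_lessI[of "g i"]) auto
    thus "lex_less c y x \<and> \<not> lex_less c x y" using lex_less_asym by blast
  qed
  hence "order_isomorphic (lex_less c) (\<Union>z\<in>I. cylinder (P z)) (lex_less c) (\<Union>z\<in>I. cylinder (Q z))"
    by (rule order_isomorphic_converse[THEN iffD1])
  thus ?thesis unfolding P_cover Q_cover .
qed

text \<open>If p is not an initial part of q, a branch through p that leaves q to side c does so at
  a place below \<open>len p\<close>. All branches through p share this exit, so the whole cylinder
  lies on that side.\<close>

lemma cylinder_Int_side_iso: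
  assumes p: "p \<in> T" and q: "q \<in> T" and ne: "cylinder p \<inter> side c q \<noteq> {}"
  shows "order_isomorphic (lex_less c) (cylinder p \<inter> side c q) (lex_less c) X"
proof (cases "p \<subseteq>\<^sub>m q")
  case False
  obtain x j where x: "x \<in> X" "p \<subseteq>\<^sub>m x" and j: "\<forall>i<j. x i = q i" "x j = Some c" "q j \<noteq> Some c"
    using ne unfolding cylinder_def side_def by blast
  have "j < len p"
  proof (rule ccontr)
    assume "\<not> j < len p"
    hence "p \<subseteq>\<^sub>m q" using x(2) j(1) unfolding le_map_iff[OF p] by auto
    thus False using False by simp
  qed
  have "cylinder p \<subseteq> side c q"
  proof
    fix y assume "y \<in> cylinder p"
    hence y: "y \<in> X" "\<And>k. k < len p \<Longrightarrow> y k = x k"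
      using x(2) unfolding cylinder_def le_map_iff[OF p] by auto
    show "y \<in> side c q" using y j \<open>j < len p\<close> by (intro sideI[of y j]) auto
  qed
  hence "cylinder p \<inter> side c q = cylinder p" by blast
  thus ?thesis using cylinder_iso[OF p] by simp
qed (rule cylinder_Int_side_iso_le[OF p q])

text \<open>Compactness gives a an immediate neighbour outside J in the direction opposite to c,
  unless a is extreme in X. The vertex at which this neighbour and a part cuts the space exactly
  between them.\<close>

lemma least_of_clopen_is_cut:
  assumes J: "clopen_convex X (branch_order T) J" and a: "a \<in> J" "\<And>y. y \<in> J \<Longrightarrow> y = a \<or> lex_less c a y"
  obtains A where "A = X \<or> (\<exists>q\<in>T. A = side c q)" "\<And>y. y \<in> X \<Longrightarrow> y \<in> A \<longleftrightarrow> y = a \<or> lex_less c a y"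
proof (cases "\<exists>z\<in>X. lex_less c z a")
  case False
  have aX: "a \<in> X" using a(1) clopen_convex_subset[OF J] by blast
  show ?thesis
    by (rule that[of X]) (use False lex_less_total[OF _ aX] in blast)+
next
  case True
  have aX: "a \<in> X" using a(1) clopen_convex_subset[OF J] by blast
  obtain z where z: "z \<in> X" "lex_less c z a" using True by blast
  have "\<exists>w\<in>X. lex_less c w a \<and> (\<forall>y\<in>X. lex_less c y a \<longrightarrow> y = w \<or> lex_less c y w)"
  proof (cases c)
    case True
    have "\<exists>w\<in>X. (w, a) \<in> branch_order T \<and>
        (\<forall>y\<in>X. (y, a) \<in> branch_order T \<longrightarrow> y = w \<or> (y, w) \<in> branch_order T)"
      by (rule predecessor_of_min[OF compact_branches J a(1) _ z(1)])
        (use a z aX True clopen_convex_subset[OF J] in \<open>auto simp: branch_order_iff\<close>)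
    thus ?thesis using True aX by (auto simp: branch_order_iff)
  next
    case False
    have "\<exists>w\<in>X. (a, w) \<in> branch_order T \<and>
        (\<forall>y\<in>X. (a, y) \<in> branch_order T \<longrightarrow> y = w \<or> (w, y) \<in> branch_order T)"
      by (rule successor_of_max[OF compact_branches J a(1) _ z(1)])
        (use a z aX False clopen_convex_subset[OF J] in \<open>auto simp: branch_order_iff lex_less_flip\<close>)
    thus ?thesis using False aX by (auto simp: branch_order_iff lex_less_flip)
  qed
  then obtain w where w: "w \<in> X" "lex_less c w a" "\<And>y. y \<in> X \<Longrightarrow> lex_less c y a \<Longrightarrow> y = w \<or> lex_less c y w"
    by blast
  \<comment> \<open>The side of this cut containing a has no point before a, since such a point
    would be w or lie before w and thus on the other side.\<close>
  obtain i where i: "i < len a" "a \<in> side c (a |` {..<i})" "w \<in> side (\<not> c) (a |` {..<i})"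
    using side_separates[OF aX w(1,2)] by blast
  let ?q = "a |` {..<i}"
  have q: "?q \<in> T" using branch_restrict[OF aX i(1)] .
  have "y \<in> side c ?q \<longleftrightarrow> y = a \<or> lex_less c a y" if y: "y \<in> X" for y
  proof
    assume ys: "y \<in> side c ?q"
    show "y = a \<or> lex_less c a y"
    proof (rule ccontr)
      assume "\<not> ?thesis"
      hence "lex_less c y a" using lex_less_total[OF y aX] by blast
      hence "y = w \<or> lex_less c y w" by (rule w(3)[OF y])
      moreover have "lex_less c w y" using side_less[OF i(3) ys] .
      ultimately show False using lex_less_irrefl lex_less_asym by blast
    qed
  next
    assume ya: "y = a \<or> lex_less c a y"
    have "y \<notin> side (\<not> c) ?q"
    proof
      assume "y \<in> side (\<not> c) ?q"
      hence "lex_less c y a" using i(2) by (rule side_less)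
      thus False using ya lex_less_irrefl lex_less_asym by blast
    qed
    thus "y \<in> side c ?q" using side_cover[OF q y] by blast
  qed
  thus ?thesis using q by (intro that[of "side c ?q"]) blast+
qed

lemma cylinder_Int_cut_iso:
  assumes p: "p \<in> T" and A: "A = X \<or> (\<exists>q\<in>T. A = side c q)" and ne: "cylinder p \<inter> A \<noteq> {}"
  shows "order_isomorphic (lex_less True) (cylinder p \<inter> A) (lex_less True) X"
proof -
  have "order_isomorphic (lex_less c) (cylinder p \<inter> A) (lex_less c) X"
    using A
  proof
    assume "A = X"
    hence "cylinder p \<inter> A = cylinder p" unfolding cylinder_def by blast
    thus ?thesis using cylinder_iso[OF p] by simp
  next
    assume "\<exists>q\<in>T. A = side c q"
    thus ?thesis using cylinder_Int_side_iso[OF p] ne by blast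
  qed
  \<comment> \<open>A bijection respecting the reversed order also respects the order, so cuts of
    either direction can be treated in one orientation.\<close>
  moreover have "order_isomorphic (lex_less False) C (lex_less False) D \<Longrightarrow>
      order_isomorphic (lex_less True) C (lex_less True) D" for C D
    unfolding order_isomorphic_def lex_less_flip by blast
  ultimately show ?thesis by (cases c) auto
qed

text \<open>Here s is the common initial part of the two end points of J, so that a extends s0 and b
  extends s1. Each half of J then has to respect only one of the two end cuts, which is the
  situation of \<open>cylinder_Int_cut_iso\<close>.\<close>

lemma clopen_convex_iso_branches:
  assumes J: "clopen_convex X (branch_order T) J" and ne: "J \<noteq> {}"
  shows "order_isomorphic (lex_less True) J (lex_less True) X"
proof -
  have JX: "J \<subseteq> X" using clopen_convex_subset[OF J] .
  have op: "openin \<tau> J" and cl: "closedin \<tau> J" using J unfolding clopen_convex_def by auto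
  obtain a where "a \<in> J" "\<forall>y\<in>J. y = a \<or> (a, y) \<in> branch_order T"
    using closed_has_min[OF compact_branches cl ne] by blast
  hence a: "a \<in> J" "\<And>y. y \<in> J \<Longrightarrow> y = a \<or> lex_less True a y" by (auto simp: branch_order_iff)
  obtain b where "b \<in> J" "\<forall>y\<in>J. y = b \<or> (y, b) \<in> branch_order T"
    using closed_has_max[OF compact_branches cl ne] by blast
  hence b: "b \<in> J" "\<And>y. y \<in> J \<Longrightarrow> y = b \<or> lex_less False b y"
    by (auto simp: branch_order_iff lex_less_flip)
  obtain A where A: "A = X \<or> (\<exists>q\<in>T. A = side True q)"
      "\<And>y. y \<in> X \<Longrightarrow> y \<in> A \<longleftrightarrow> y = a \<or> lex_less True a y"
    using least_of_clopen_is_cut[OF J a] by blast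
  \<comment> \<open>The maximum of J is its least point for the reversed order
    \<open>lex_less False\<close>, so the same lemma describes the right end.\<close>
  obtain B where B: "B = X \<or> (\<exists>q\<in>T. B = side False q)"
      "\<And>y. y \<in> X \<Longrightarrow> y \<in> B \<longleftrightarrow> y = b \<or> lex_less True y b"
    using least_of_clopen_is_cut[OF J b] unfolding lex_less_flip by blast
  have aX: "a \<in> X" and bX: "b \<in> X" using a(1) b(1) JX by auto
  \<comment> \<open>J is open and the space is perfect, so J is not a single point; its end points
    differ and have a place of separation.\<close>
  obtain z where "z \<in> J" "z \<noteq> a" by (rule perfect_other_point[OF perfect_branches op a(1)])
  hence "b \<noteq> a" using a(2)[of z] b(2)[of z] lex_less_asym unfolding lex_less_flip by blast
  hence "lex_less True a b" using a(2)[OF b(1)] by blast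
  then obtain \<epsilon> where e: "\<forall>i<\<epsilon>. a i = b i" "a \<epsilon> = Some False" "b \<epsilon> = Some True"
    unfolding lex_less_def by auto
  define s where "s = a |` {..<\<epsilon>}"
  have el: "\<epsilon> < len a" using e(2) branch_dom[OF aX] by blast
  have s: "s \<in> T" and ls: "len s = \<epsilon>"
    unfolding s_def using branch_restrict[OF aX el] branch_restrict_atMost(2)[OF aX el] by auto
  let ?s = "\<lambda>b. s(\<epsilon> \<mapsto> b)"
  have sT: "?s b \<in> T" for b using tree_snoc[OF s, of b] ls by simp
  have sc: "cylinder (?s b) = {y \<in> cylinder s. y \<epsilon> = Some b}" for b using snoc_cylinder[OF s, of b] ls by simp
  have as: "a \<in> cylinder s" using aX le_map_iff[OF s, of a] by (simp add: cylinder_def ls) (simp add: s_def)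
  have bs: "b \<in> cylinder s" using bX le_map_iff[OF s, of b] e(1) by (simp add: cylinder_def ls) (simp add: s_def)
  have agree: "y i = x i" if "y \<in> cylinder s" "x \<in> cylinder s" "i < \<epsilon>" for x y i
    using that le_map_iff[OF s] unfolding cylinder_def ls by auto
  \<comment> \<open>Convexity of cylinders keeps J within s + X. A point through s0 is automatically
    before b and a point through s1 automatically beyond a, which leaves one cut for each
    half.\<close>
  have J_eq: "J = (cylinder (?s False) \<inter> A) \<union> (cylinder (?s True) \<inter> B)"
  proof (intro equalityI subsetI)
    fix y assume y: "y \<in> J"
    have yX: "y \<in> X" using y JX by blast
    have ay: "y = a \<or> lex_less True a y" and yb: "y = b \<or> lex_less True y b"
      using a(2)[OF y] b(2)[OF y] unfolding lex_less_flip by auto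
    have "y \<in> cylinder s" using ay yb as bs cylinder_convex[OF s as bs yX] by blast
    hence "y \<in> cylinder (?s False) \<or> y \<in> cylinder (?s True)" using cylinder_split[OF s] ls by auto
    moreover have "y \<in> A" "y \<in> B" using A(2)[OF yX] B(2)[OF yX] ay yb by auto
    ultimately show "y \<in> (cylinder (?s False) \<inter> A) \<union> (cylinder (?s True) \<inter> B)" by blast
  next
    fix y assume y: "y \<in> (cylinder (?s False) \<inter> A) \<union> (cylinder (?s True) \<inter> B)"
    hence yX: "y \<in> X" and ys: "y \<in> cylinder s" unfolding sc by (auto simp: cylinder_def)
    have "(y = a \<or> lex_less True a y) \<and> (y = b \<or> lex_less True y b)"
      using y
    proof
      assume y: "y \<in> cylinder (?s False) \<inter> A"
      hence "lex_less True y b" using agree[OF ys bs] e(3) unfolding sc by (intro lex_lessI[of \<epsilon>]) auto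
      thus ?thesis using y A(2)[OF yX] by blast
    next
      assume y: "y \<in> cylinder (?s True) \<inter> B"
      hence "lex_less True a y" using agree[OF as ys] e(2) unfolding sc by (intro lex_lessI[of \<epsilon>]) auto
      thus ?thesis using y B(2)[OF yX] by blast
    qed
    moreover have "y \<in> J" if "lex_less True a y" "lex_less True y b"
    proof -
      have "(a, y) \<in> branch_order T" "(y, b) \<in> branch_order T"
        using that yX aX bX by (simp_all add: branch_order_iff)
      thus ?thesis using J a(1) b(1) yX unfolding clopen_convex_def order_convex_def by blast
    qed
    ultimately show "y \<in> J" using a(1) b(1) by blast
  qed
  let ?e = "\<lambda>b. [ord_zero \<mapsto> b] :: 'o \<rightharpoonup> bool"
  have eT: "?e b \<in> T" for b using tree_snoc[OF empty_in_tree, of b] by (simp add: len_empty)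
  have ec: "cylinder (?e b) = {y \<in> X. y ord_zero = Some b}" for b
    using snoc_cylinder[OF empty_in_tree, of b] by (simp add: len_empty cylinder_empty)
  have X_eq: "X = cylinder (?e False) \<union> cylinder (?e True)"
    using cylinder_split[OF empty_in_tree] by (simp add: len_empty cylinder_empty)
  have iso0: "order_isomorphic (lex_less True) (cylinder (?s False) \<inter> A) (lex_less True) (cylinder (?e False))"
  proof (rule order_isomorphic_trans[OF cylinder_Int_cut_iso[OF sT A(1)] order_isomorphic_sym[OF cylinder_iso[OF eT]]])
    show "cylinder (?s False) \<inter> A \<noteq> {}" using as e(2) A(2)[OF aX] unfolding sc by blast
  qed
  have iso1: "order_isomorphic (lex_less True) (cylinder (?s True) \<inter> B) (lex_less True) (cylinder (?e True))"
  proof (rule order_isomorphic_trans[OF cylinder_Int_cut_iso[OF sT B(1)] order_isomorphic_sym[OF cylinder_iso[OF eT]]])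
    show "cylinder (?s True) \<inter> B \<noteq> {}" using bs e(3) B(2)[OF bX] unfolding sc by blast
  qed
  have "order_isomorphic (lex_less True) ((cylinder (?s False) \<inter> A) \<union> (cylinder (?s True) \<inter> B))
      (lex_less True) (cylinder (?e False) \<union> cylinder (?e True))"
  proof (rule order_isomorphic_Un[OF iso0 iso1])
    fix x y assume "x \<in> cylinder (?s False) \<inter> A" "y \<in> cylinder (?s True) \<inter> B"
    hence "x \<in> cylinder s" "x \<epsilon> = Some False" "y \<in> cylinder s" "y \<epsilon> = Some True" unfolding sc by auto
    hence "lex_less True x y" using agree[of y x] by (intro lex_lessI[of \<epsilon>]) auto
    thus "lex_less True x y \<and> \<not> lex_less True y x" using lex_less_asym by blast
  next
    fix x y assume "x \<in> cylinder (?e False)" "y \<in> cylinder (?e True)"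
    hence "x ord_zero = Some False" "y ord_zero = Some True" unfolding ec by auto
    moreover have "\<not> i < ord_zero" for i :: 'o using ord_zero_le[of i] by (simp add: not_less)
    ultimately have "lex_less True x y" by (intro lex_lessI[of ord_zero]) auto
    thus "lex_less True x y \<and> \<not> lex_less True y x" using lex_less_asym by blast
  qed
  thus ?thesis by (simp only: J_eq[symmetric] X_eq[symmetric])
qed

lemma clopen_interval_condition_branches: "clopen_interval_condition X (branch_order T)"
  unfolding clopen_interval_condition_def
proof (intro allI impI, elim conjE)
  fix J K
  assume J: "clopen_convex X (branch_order T) J" "J \<noteq> {}"
    and K: "clopen_convex X (branch_order T) K" "K \<noteq> {}"
  have "order_isomorphic (lex_less True) J (lex_less True) K"
    by (rule order_isomorphic_trans[OF clopen_convex_iso_branches[OF J]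
      order_isomorphic_sym[OF clopen_convex_iso_branches[OF K]]])
  moreover have "lex_less True x y \<longleftrightarrow> (x, y) \<in> branch_order T" if "x \<in> X" "y \<in> X" for x y
    using that by (simp add: branch_order_iff)
  ultimately show "order_isomorphic (\<lambda>x y. (x, y) \<in> branch_order T) J (\<lambda>x y. (x, y) \<in> branch_order T) K"
    using order_isomorphic_cong[of J "lex_less True" "\<lambda>x y. (x, y) \<in> branch_order T"
        K "lex_less True" "\<lambda>x y. (x, y) \<in> branch_order T"]
      clopen_convex_subset[OF J(1)] clopen_convex_subset[OF K(1)] by (meson subsetD)
qed

end

theorem theorem1p8:
  fixes \<alpha> :: "'o::wellorder" and T :: "('o \<rightharpoonup> bool) set"
  assumes "additive_tree T \<alpha>"
    and "tail_like \<alpha>"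
    and "len (const_branch T False) = \<alpha>"
    and "len (const_branch T True) = \<alpha>"
  shows "lots (branch_space T) (branch_order T) \<and>
         compact_space (branch_topology T) \<and>
         perfect_lots (branch_space T) (branch_order T) \<and>
         zero_dimensional_lots (branch_space T) (branch_order T) \<and>
         clopen_interval_condition (branch_space T) (branch_order T) \<and>
         (countable {..<\<alpha>} \<longrightarrow> topologically_homogeneous (branch_topology T))"
proof -
  have "len (const_branch T b) = \<alpha>" for b using assms(3,4) by (cases b) simp_all
  then interpret tail_like_tree T \<alpha> using assms(1,2) by unfold_locales
  show ?thesis
    using lots_branches compact_branches perfect_branches zero_dimensional_branches
      clopen_interval_condition_branches homogeneous_if_first_countable first_countable_branches
    by blast
qed

end
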